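(* Assume that $\inf_{x\in D}R(x)>0$, that the sequence of positive functions $\beta_n\in\mathcal{B}(D)$, $n\ge 0$, is uniformly bounded (i.e. $\sup_n\sup_{x\in D}\beta_n(x)<\infty$) and converges uniformly on $D$, as $n\to\infty$, to a function $\beta\in\mathcal{B}(D)$ such that $\inf_{x\in D}\beta(x)>0$. Assume in addition that $$|\beta_n(x)-\beta(x)|\le\tau(x)\varphi(n)\qquad\text{for all } n\ge0,\ x\in D,$$ where the function $\varphi(s)>0$, $s\ge0$, is such that $\varphi(s)\to0$ as $s\to\infty$ and for any $\delta>0$ $$\frac{1}{\sqrt n}\sum_{k=0}^n\varphi(k\delta)\to0\quad\text{as } n\to\infty,$$ and the function $\tau\in\mathcal{B}(D)$ is such that $\inf_{x\in D}\tau(x)>0$. Then the sequence of centred and rescaled random measures $(\mu_m-\mathsf{E}\mu_m)/\sqrt m$ converges, as $m\to\infty$, to a generalized Gaussian random field on $D$ with zero mean and covariance kernel $$G(f,g)=J(fg)-J(f)J(g)=\frac1\alpha\int_D f(x)g(x)\beta(x)\,dx-\frac{1}{\alpha^2}\int_D f(x)\beta(x)\,dx\int_D g(x)\beta(x)\,dx,\qquad f,g\in\mathcal{B}(D),$$ where $\alpha=\int_D\beta(x)\,dx$ and $J(f)=\frac1\alpha\int_D f(x)\beta(x)\,dx$. That is, for any finite collection $f_1,\dots,f_q\in\mathcal{B}(D)$ the random vector with components $\frac{1}{\sqrt m}\sum_{k=1}^m\bigl(f_j(X_k)-\mathsf{E}f_j(X_k)\bigr)$, $j=1,\dots,q$,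 converges in distribution, as $m\to\infty$, to a centred Gaussian vector with covariance matrix $\bigl(G(f_i,f_j)\bigr)_{i,j=1}^q$.
   Context: Let $D\subset\mathbf{R}^d$ be a compact set of positive Lebesgue measure and let $\mathcal{B}(D)$ be the set of real-valued measurable bounded functions on $D$. Let $R:D\to\mathbf{R}_+$ be a measurable function (interaction radius). For $x\in D$ and a finite non-empty set $\mathbf{y}=\{y_1,\dots,y_n\}$ of points of $D$, $n(x,\mathbf{y})$ denotes the number of points $y_i\in\mathbf{y}$ whose distance to $x$ is not greater than $R(x)$; by definition $n(x,\emptyset)=0$. Let $\{\beta_n(x),\,n\ge 0\}$ be a sequence of measurable positive bounded functions on $D$. The random points $X_1,X_2,\dots$ in $D$ are defined sequentially on a probability space with measure $\mathsf{P}$ and expectation $\mathsf{E}$: writing $X(k)=(X_1,\dots,X_k)$ for $k\ge1$ and $X(0)=\emptyset$, the conditional distribution of $X_{k+1}$ given $X(k)$ ($k\ge 0$) has probability density $$\psi_{k+1}(x)=\frac{\beta_{n(x,X(k))}(x)}{\alpha(X(k))},\quad x\in D,\qquad \alpha(X(k))=\int_D\beta_{n(u,X(k))}(u)\,du .$$ The random point measures are $\mu_m=\sum_{i=1}^m\delta_{X_i}$. *)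

theory Defs
  imports "HOL-Probability.Probability"
begin

definition bounded_measurable_on :: "'a::euclidean_space set \<Rightarrow> ('a \<Rightarrow> real) set" where
  "bounded_measurable_on D = {f \<in> borel_measurable (restrict_space borel D). bounded (f ` D)}"


subsection \<open>Sequential point process with local interaction\<close>

definition neighbour_count :: "('a::metric_space \<Rightarrow> real) \<Rightarrow> 'a \<Rightarrow> 'a set \<Rightarrow> nat" where
  "neighbour_count R x Y = card {y \<in> Y. dist x y \<le> R x}"

definition normalizer ::
  "'a::euclidean_space set \<Rightarrow> ('a \<Rightarrow> real) \<Rightarrow> (nat \<Rightarrow> 'a \<Rightarrow> real) \<Rightarrow> 'a set \<Rightarrow> real" where
  "normalizer D R \<beta> Y = (LINT u:D|lborel. \<beta> (neighbour_count R u Y) u)"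

definition next_density ::
  "'a::euclidean_space set \<Rightarrow> ('a \<Rightarrow> real) \<Rightarrow> (nat \<Rightarrow> 'a \<Rightarrow> real) \<Rightarrow> 'a set \<Rightarrow> 'a \<Rightarrow> real" where
  "next_density D R \<beta> Y x = \<beta> (neighbour_count R x Y) x / normalizer D R \<beta> Y"

text \<open>The sigma-algebra on the sample space generated by the first \<open>k\<close> points (trivial for
  \<open>k = 0\<close>). Points are numbered from 1; \<open>X 0\<close> is never used.\<close>

definition past ::
  "'w measure \<Rightarrow> 'a::euclidean_space set \<Rightarrow> (nat \<Rightarrow> 'w \<Rightarrow> 'a) \<Rightarrow> nat \<Rightarrow> 'w measure" where
  "past M D X k = vimage_algebra (space M) (\<lambda>\<omega>. \<lambda>i\<in>{1..k}. X i \<omega>)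
     (\<Pi>\<^sub>M i\<in>{1..k}. restrict_space borel D)"

text \<open>The second clause says that, given the first \<open>k\<close> points, the next one has density
  \<open>next_density\<close> on \<open>D\<close>: a version of the conditional probability of
  \<open>X (k + 1) \<in> A\<close> is the integral of that density over \<open>A\<close>, for every Borel \<open>A \<subseteq> D\<close>.\<close>

definition sequential_point_process ::
  "'w measure \<Rightarrow> 'a::euclidean_space set \<Rightarrow> ('a \<Rightarrow> real) \<Rightarrow> (nat \<Rightarrow> 'a \<Rightarrow> real) \<Rightarrow>
    (nat \<Rightarrow> 'w \<Rightarrow> 'a) \<Rightarrow> bool" where
  "sequential_point_process M D R \<beta> X \<longleftrightarrow>
     (\<forall>k\<ge>1. X k \<in> M \<rightarrow>\<^sub>M restrict_space borel D) \<and>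
     (\<forall>k. \<forall>A\<in>sets (restrict_space borel D). AE \<omega> in M.
        real_cond_exp M (past M D X k) (\<lambda>\<omega>. indicator A (X (k + 1) \<omega>)) \<omega> =
        (LINT x:A|lborel. next_density D R \<beta> ((\<lambda>i. X i \<omega>) ` {1..k}) x))"


subsection \<open>The limiting covariance\<close>

definition weighted_mean :: "'a::euclidean_space set \<Rightarrow> ('a \<Rightarrow> real) \<Rightarrow> ('a \<Rightarrow> real) \<Rightarrow> real" where
  "weighted_mean D b f = (1 / (LINT x:D|lborel. b x)) * (LINT x:D|lborel. f x * b x)"

definition limit_cov ::
  "'a::euclidean_space set \<Rightarrow> ('a \<Rightarrow> real) \<Rightarrow> ('a \<Rightarrow> real) \<Rightarrow> ('a \<Rightarrow> real) \<Rightarrow> real" where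
  "limit_cov D b f g =
     weighted_mean D b (\<lambda>x. f x * g x) - weighted_mean D b f * weighted_mean D b g"

lemma limit_cov_eq:
  fixes D :: "'a::euclidean_space set"
  defines "\<alpha> \<equiv> \<lambda>b. LINT x:D|lborel. b x"
  shows "limit_cov D b f g =
     (1 / \<alpha> b) * (LINT x:D|lborel. f x * g x * b x)
     - (1 / (\<alpha> b)\<^sup>2) * (LINT x:D|lborel. f x * b x) * (LINT x:D|lborel. g x * b x)"
  by (simp add: limit_cov_def weighted_mean_def \<alpha>_def power2_eq_square)


subsection \<open>Gaussian vectors and convergence in distribution\<close>

text \<open>Degenerate (constant) normal laws are included, as a limiting covariance matrix need not
  be invertible.\<close>

definition normal_law :: "real \<Rightarrow> real \<Rightarrow> real measure" where
  "normal_law m \<sigma> =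
     (if \<sigma> = 0 then return borel m else density lborel (\<lambda>x. ennreal (normal_density m \<sigma> x)))"

definition gaussian_measure :: "'b::euclidean_space measure \<Rightarrow> bool" where
  "gaussian_measure N \<longleftrightarrow> prob_space N \<and> sets N = sets borel \<and>
     (\<forall>t. \<exists>m \<sigma>. \<sigma> \<ge> 0 \<and> distr N borel (\<lambda>v. t \<bullet> v) = normal_law m \<sigma>)"

definition covariance :: "'w measure \<Rightarrow> ('w \<Rightarrow> real) \<Rightarrow> ('w \<Rightarrow> real) \<Rightarrow> real" where
  "covariance M U V =
     (\<integral>\<omega>. (U \<omega> - (\<integral>\<omega>'. U \<omega>' \<partial>M)) * (V \<omega> - (\<integral>\<omega>'. V \<omega>' \<partial>M)) \<partial>M)"

definition centred_gaussian_with_cov ::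
  "(real ^ 'q) measure \<Rightarrow> ('q \<Rightarrow> 'q \<Rightarrow> real) \<Rightarrow> bool" where
  "centred_gaussian_with_cov N \<Sigma> \<longleftrightarrow> gaussian_measure N \<and>
     (\<forall>i. (\<integral>v. v $ i \<partial>N) = 0) \<and>
     (\<forall>i j. covariance N (\<lambda>v. v $ i) (\<lambda>v. v $ j) = \<Sigma> i j)"

definition converges_in_distribution ::
  "'w measure \<Rightarrow> (nat \<Rightarrow> 'w \<Rightarrow> 'b::topological_space) \<Rightarrow> 'b measure \<Rightarrow> bool" where
  "converges_in_distribution M V N \<longleftrightarrow>
     (\<forall>h :: 'b \<Rightarrow> real. continuous_on UNIV h \<and> bounded (range h) \<longrightarrow>
        (\<lambda>m. \<integral>\<omega>. h (V m \<omega>) \<partial>M) \<longlonglongrightarrow> (\<integral>v. h v \<partial>N))"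

end

theory Submission
  imports Defs
begin

text \<open>
  A telescoping argument compares the characteristic function of the partial sums with the one of an
  i.i.d. sample of density \<open>\<beta> / \<alpha>\<close>: replacing one point costs \<open>O(1 / sqrt m)\<close> times the expected
  \<open>L\<^sup>1\<close> distance of the conditional density from \<open>\<beta> / \<alpha>\<close>. That distance is at most a constant times
  the integral of \<open>\<phi>\<close> evaluated at the neighbour count. For almost every \<open>x\<close> the neighbour count at
  \<open>x\<close> increases with conditional probability bounded below, so it spends a bounded expected time at
  each level, and the distances of the first \<open>m\<close> steps add up to \<open>O(\<Sum>j<m. \<phi> j) = o(sqrt m)\<close>.
  Hence both the replacement error and the bias of the centring vanish.
\<close>

subsection \<open>Convergence of characteristic functions in Euclidean space\<close>

text \<open>Since \<open>\<phi>\<close> is not assumed monotone, a lower bound on the neighbour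
  counts would not control \<open>\<phi>\<close> along them. The expected time spent at each level
  does control it, because every level then contributes its own value of \<open>\<phi>\<close>, at
  most 1 / p times. The bound p must be uniform in time and history, although the functions
  \<open>\<beta>s n\<close> may have no common positive lower bound on D and D may have no mass near
  some of its points. Integration removes both obstacles: the infimum over n is a positive function,
  so its integral over any set of positive measure is positive, and D is covered by finitely many
  cells narrow enough to lie in the interaction ball of each of their points. The null cells form
  the exceptional set. The factor 1 / sqrt m in the replacement cost arises because both densities
  integrate to 1: a constant may be subtracted from the character of a summand, and that character
  differs from 1 by only O(1 / sqrt m). The limiting covariance may be singular. The Gaussian vector
  is therefore built as a linear image of independent standard normals and not from a
  density.\<close>

inductive trig_poly :: "('b::real_inner \<Rightarrow> complex) \<Rightarrow> bool" where
  char: "trig_poly (\<lambda>x. c * iexp (t \<bullet> x))"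
| add: "trig_poly F \<Longrightarrow> trig_poly G \<Longrightarrow> trig_poly (\<lambda>x. F x + G x)"

lemma trig_poly_const: "trig_poly (\<lambda>x. c)"
  using trig_poly.char[of c 0] by simp

text \<open>Frequencies add when characters are multiplied. Closure under products turns a
  polynomial in sines, as Stone-Weierstrass delivers it, into a finite sum of characters, to which
  convergence of characteristic functions applies term by term.\<close>

lemma trig_poly_mult:
  assumes "trig_poly F" "trig_poly G"
  shows "trig_poly (\<lambda>x. F x * G x)"
  using assms(1)
proof induction
  case (char c t)
  from assms(2) show ?case
  proof induction
    case (char d u)
    have "(\<lambda>x. c * iexp (t \<bullet> x) * (d * iexp (u \<bullet> x))) = (\<lambda>x. (c * d) * iexp ((t + u) \<bullet> x))"
      by (auto simp: inner_add_left exp_add[symmetric] algebra_simps)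
    then show ?case by (metis trig_poly.char)
  next
    case (add F G)
    then show ?case using trig_poly.add by (fastforce simp: distrib_left)
  qed
next
  case (add F G)
  then show ?case using trig_poly.add by (fastforce simp: distrib_right)
qed

lemma trig_poly_sum: "(\<And>i. i \<in> I \<Longrightarrow> trig_poly (F i)) \<Longrightarrow> trig_poly (\<lambda>x. \<Sum>i\<in>I. F i x)"
  by (induction I rule: infinite_finite_induct) (auto intro: trig_poly_const trig_poly.add)

lemma trig_poly_sin: "trig_poly (\<lambda>x. complex_of_real (sin (t \<bullet> x)))"
proof -
  have eq: "complex_of_real (sin y) = (- \<i> / 2) * iexp y + (\<i> / 2) * iexp (- y)" for y :: real
    unfolding cis_conv_exp[symmetric] of_real_minus[symmetric] by (simp add: complex_eq_iff)
  have "(\<lambda>x. complex_of_real (sin (t \<bullet> x)))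
      = (\<lambda>x. (- \<i> / 2) * iexp (t \<bullet> x) + (\<i> / 2) * iexp ((- t) \<bullet> x))"
    by (subst eq) simp
  then show ?thesis using trig_poly.add[OF trig_poly.char trig_poly.char] by metis
qed

lemma continuous_trig_poly: "trig_poly F \<Longrightarrow> continuous_on UNIV F"
  by (induction rule: trig_poly.induct) (auto intro!: continuous_intros)

lemma bounded_trig_poly: "trig_poly F \<Longrightarrow> \<exists>B. \<forall>x. norm (F x) \<le> B"
proof (induction rule: trig_poly.induct)
  case (char c t) show ?case by (rule exI[of _ "norm c"]) (simp add: norm_mult)
next
  case (add F G)
  then obtain B C where "\<forall>x. norm (F x) \<le> B" "\<forall>x. norm (G x) \<le> C" by blast
  then have "\<forall>x. norm (F x + G x) \<le> B + C" by (meson add_mono norm_triangle_le)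
  then show ?case by blast
qed

text \<open>Coordinatewise sines carry the noncompact space into the compact cube with coordinates
  in [-1, 1], where Stone-Weierstrass applies. A polynomial composed with this map is a
  trigonometric polynomial.\<close>

definition sine_map :: "real \<Rightarrow> 'b::euclidean_space \<Rightarrow> 'b" where
  "sine_map \<theta> x = (\<Sum>b\<in>Basis. sin (\<theta> * (x \<bullet> b)) *\<^sub>R b)"

lemma sine_map_inner [simp]: "b \<in> Basis \<Longrightarrow> sine_map \<theta> x \<bullet> b = sin (\<theta> * (x \<bullet> b))"
  unfolding sine_map_def by (simp add: inner_sum_left_Basis)

lemma trig_poly_real_polynomial_sine_map:
  "real_polynomial_function P \<Longrightarrow> trig_poly (\<lambda>x. complex_of_real (P (sine_map \<theta> x)))"
proof (induction rule: real_polynomial_function.induct)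
  case (linear f)
  then interpret bounded_linear f .
  have "trig_poly (\<lambda>x. \<Sum>b\<in>Basis. complex_of_real (sin ((\<theta> *\<^sub>R b) \<bullet> x)) * complex_of_real (f b))"
    by (intro trig_poly_sum trig_poly_mult trig_poly_sin trig_poly_const)
  then show ?case
    by (simp add: sine_map_def sum scaleR inner_commute)
qed (auto intro: trig_poly_const trig_poly.add trig_poly_mult)

text \<open>On the box the arcsine inverts \<open>sine_map\<close>, and off the box the approximant stays
  bounded because it factors through the compact cube of sines.\<close>

lemma trig_poly_approx_on_box:
  fixes h :: "'b::euclidean_space \<Rightarrow> real"
  assumes h: "continuous_on UNIV h" and B: "\<And>x. \<bar>h x\<bar> \<le> B" and K: "K > 0" and e: "\<epsilon> > 0"
  obtains F :: "'b \<Rightarrow> real" where "trig_poly (\<lambda>x. complex_of_real (F x))" "\<And>x. \<bar>F x\<bar> \<le> B + \<epsilon>"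
    "\<And>x. (\<And>b. b \<in> Basis \<Longrightarrow> \<bar>x \<bullet> b\<bar> \<le> K) \<Longrightarrow> \<bar>h x - F x\<bar> \<le> \<epsilon>"
proof -
  \<comment> \<open>This scaling sends the half-side \<open>K\<close> of the box to pi / 2, the end
    of the interval on which the arcsine inverts the sine.\<close>
  define \<theta> where "\<theta> = pi / (2 * K)"
  have \<theta>: "\<theta> > 0" using K by (simp add: \<theta>_def)
  define A where "A = (\<lambda>s::'b. \<Sum>b\<in>Basis. (arcsin (s \<bullet> b) / \<theta>) *\<^sub>R b)"
  define C where "C = cbox (- One) (One :: 'b)"
  have C: "s \<in> C \<longleftrightarrow> (\<forall>b\<in>Basis. -1 \<le> s \<bullet> b \<and> s \<bullet> b \<le> 1)" for s
    by (auto simp: C_def mem_box)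
  have "continuous_on C A"
    unfolding A_def using \<theta> by (intro continuous_intros) (auto simp: C)
  then have "continuous_on C (h \<circ> A)"
    using h by (intro continuous_on_compose) (auto intro: continuous_on_subset)
  moreover have "compact C" by (simp add: C_def)
  ultimately obtain P where P: "real_polynomial_function P" "\<And>s. s \<in> C \<Longrightarrow> \<bar>(h \<circ> A) s - P s\<bar> < \<epsilon>"
    using Stone_Weierstrass_real_polynomial_function[of C "h \<circ> A" \<epsilon>] e by auto
  have inC: "sine_map \<theta> x \<in> C" for x by (simp add: C)
  show ?thesis
  proof
    show "trig_poly (\<lambda>x. complex_of_real (P (sine_map \<theta> x)))"
      by (rule trig_poly_real_polynomial_sine_map) fact
    show "\<bar>P (sine_map \<theta> x)\<bar> \<le> B + \<epsilon>" for x
      using P(2)[OF inC, of x] B[of "A (sine_map \<theta> x)"] by simp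
    fix x :: 'b assume x: "\<And>b. b \<in> Basis \<Longrightarrow> \<bar>x \<bullet> b\<bar> \<le> K"
    have "arcsin (sin (\<theta> * (x \<bullet> b))) = \<theta> * (x \<bullet> b)" if "b \<in> Basis" for b
    proof (rule arcsin_sin)
      have "\<bar>\<theta> * (x \<bullet> b)\<bar> \<le> \<theta> * K" using x[OF that] \<theta> by (simp add: abs_mult)
      moreover have "\<theta> * K = pi / 2" using K by (simp add: \<theta>_def)
      ultimately show "- (pi / 2) \<le> \<theta> * (x \<bullet> b)" "\<theta> * (x \<bullet> b) \<le> pi / 2"
        by linarith+
    qed
    then have "A (sine_map \<theta> x) = (\<Sum>b\<in>Basis. (x \<bullet> b) *\<^sub>R b)"
      unfolding A_def using \<theta> by (intro sum.cong) auto
    then have "A (sine_map \<theta> x) = x" by (simp add: euclidean_representation)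
    then show "\<bar>h x - P (sine_map \<theta> x)\<bar> \<le> \<epsilon>"
      using P(2)[OF inC, of x] by simp
  qed
qed

text \<open>A continuous substitute for the indicator of \<open>\<bar>y\<bar> > K\<close>, rising
  from 0 to 1 between K and K + 1, so that its means pass to a weak limit.\<close>

definition excess :: "real \<Rightarrow> real \<Rightarrow> real" where
  "excess K y = min 1 (max 0 (\<bar>y\<bar> - K))"

lemma excess_bounds: "0 \<le> excess K y" "excess K y \<le> 1" "\<bar>y\<bar> > K + 1 \<Longrightarrow> excess K y = 1"
  by (auto simp: excess_def)

lemma excess_measurable [measurable]: "excess K \<in> borel_measurable borel"
  unfolding excess_def by measurable

lemma isCont_excess: "isCont (excess K) y"
  unfolding excess_def by (intro continuous_intros)

text \<open>On a large box \<open>h\<close> is uniformly close to a trigonometric polynomial, whose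
  means converge by linearity. Off the box the two differ by a bounded amount, which is charged to
  the excess of some coordinate. The mean excess is small under \<open>N\<close> for a large box,
  and it converges along the sequence, so tightness is a by-product of the one-dimensional
  theorem.\<close>

lemma levy_continuity_euclidean:
  fixes V :: "nat \<Rightarrow> 'w \<Rightarrow> 'b::euclidean_space" and N :: "'b measure"
  assumes "prob_space M" and V: "\<And>m. V m \<in> borel_measurable M"
    and "prob_space N" and sets_N: "sets N = sets borel"
    and char: "\<And>t. (\<lambda>m. \<integral>\<omega>. iexp (t \<bullet> V m \<omega>) \<partial>M) \<longlonglongrightarrow> (\<integral>v. iexp (t \<bullet> v) \<partial>N)"
  shows "converges_in_distribution M V N"
  unfolding converges_in_distribution_def
proof (intro allI impI, elim conjE)
  interpret M: prob_space M by fact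
  interpret N: prob_space N by fact
  note V [measurable]
  have sets_N' [measurable_cong]: "sets N = sets borel" by fact
  fix h :: "'b \<Rightarrow> real" assume h: "continuous_on UNIV h" and "bounded (range h)"
  then obtain B where B: "\<And>x. \<bar>h x\<bar> \<le> B" by (auto simp: bounded_iff)
  have B0: "B \<ge> 0" using B[of 0] by linarith
  have [measurable]: "h \<in> borel_measurable borel" using h by (rule borel_measurable_continuous_onI)
  have trig: "(\<lambda>m. \<integral>\<omega>. F (V m \<omega>) \<partial>M) \<longlonglongrightarrow> (\<integral>v. F v \<partial>N)" if "trig_poly F" for F
    using that
  proof induction
    case (char c t)
    show ?case using tendsto_mult_left[OF assms(5)[of t], of c] by simp
  next
    case (add F G)
    have I: "integrable M (\<lambda>\<omega>. H (V m \<omega>))" "integrable N H" if H: "trig_poly H" for H m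
    proof -
      have [measurable]: "H \<in> borel_measurable borel"
        using H by (intro borel_measurable_continuous_onI continuous_trig_poly)
      obtain C where "\<And>x. norm (H x) \<le> C" using bounded_trig_poly[OF H] by blast
      then show "integrable M (\<lambda>\<omega>. H (V m \<omega>))" "integrable N H"
        by (auto intro!: M.integrable_const_bound[of _ C] N.integrable_const_bound[of _ C])
    qed
    show ?case using tendsto_add[OF add.IH] by (simp add: I add.hyps)
  qed
  have tight: "(\<lambda>m. \<integral>\<omega>. excess K (V m \<omega> \<bullet> b) \<partial>M) \<longlonglongrightarrow> (\<integral>v. excess K (v \<bullet> b) \<partial>N)" for K b
  proof -
    define D where "D = (\<lambda>m. distr M borel (\<lambda>\<omega>. V m \<omega> \<bullet> b))"
    define D' where "D' = distr N borel (\<lambda>v. v \<bullet> b)"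
    have rd: "real_distribution (D m)" "real_distribution D'" for m
      unfolding D_def D'_def by (auto intro!: M.real_distribution_distr N.real_distribution_distr)
    \<comment> \<open>The characteristic function of a projection at t is the multivariate one at t
      times \<open>b\<close>, so the one-dimensional continuity theorem applies to each
      projection.\<close>
    have "weak_conv_m D D'"
    proof (rule levy_continuity[OF rd])
      fix t
      have "char (D m) t = (\<integral>\<omega>. iexp ((t *\<^sub>R b) \<bullet> V m \<omega>) \<partial>M)" for m
        unfolding D_def char_def by (subst integral_distr) (auto simp: inner_commute)
      moreover have "char D' t = (\<integral>v. iexp ((t *\<^sub>R b) \<bullet> v) \<partial>N)"
        unfolding D'_def char_def by (subst integral_distr) (auto simp: inner_commute)
      ultimately show "(\<lambda>m. char (D m) t) \<longlonglongrightarrow> char D' t"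
        using char[of "t *\<^sub>R b"] by simp
    qed
    then have "(\<lambda>m. integral\<^sup>L (D m) (excess K)) \<longlonglongrightarrow> integral\<^sup>L D' (excess K)"
      using rd by (intro weak_conv_imp_integral_bdd_continuous_conv[where B=1] isCont_excess)
        (auto simp: excess_bounds)
    then show ?thesis unfolding D_def D'_def by (simp add: integral_distr)
  qed
  have excess_N: "(\<lambda>n. \<Sum>b\<in>Basis. \<integral>v. excess (real n) (v \<bullet> b) \<partial>N) \<longlonglongrightarrow> (\<Sum>b\<in>(Basis::'b set). 0)"
  proof (intro tendsto_sum)
    fix b :: 'b
    have "(\<lambda>n. excess (real n) y) \<longlonglongrightarrow> 0" for y
    proof (rule tendsto_eventually, rule eventually_sequentiallyI)
      fix n assume "n \<ge> nat \<lceil>\<bar>y\<bar>\<rceil>"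
      then have "\<bar>y\<bar> \<le> real n" by linarith
      then show "excess (real n) y = 0" by (simp add: excess_def)
    qed
    then have "(\<lambda>n. \<integral>v. excess (real n) (v \<bullet> b) \<partial>N) \<longlonglongrightarrow> (\<integral>v. 0 \<partial>N)"
      by (intro integral_dominated_convergence[where w="\<lambda>_. 1"]) (auto simp: excess_bounds)
    then show "(\<lambda>n. \<integral>v. excess (real n) (v \<bullet> b) \<partial>N) \<longlonglongrightarrow> 0" by simp
  qed
  show "(\<lambda>m. \<integral>\<omega>. h (V m \<omega>) \<partial>M) \<longlonglongrightarrow> (\<integral>v. h v \<partial>N)"
  proof (rule LIMSEQ_I)
    fix r :: real assume r: "r > 0"
    \<comment> \<open>The final estimate spends 2 \<epsilon> on replacing h by F under
      \<open>M\<close>, 2 \<epsilon> on the same under \<open>N\<close>, and \<epsilon> on the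
      convergence of the means of F. The cap at 1 lets \<open>c = 2 * B + 1\<close> dominate the
      crude bound \<open>2 * B + \<epsilon>\<close> off the box.\<close>
    define \<epsilon> where "\<epsilon> = min 1 (r / 5)"
    have \<epsilon>: "\<epsilon> > 0" "\<epsilon> \<le> 1" "5 * \<epsilon> \<le> r" using r by (auto simp: \<epsilon>_def)
    define c where "c = 2 * B + 1"
    have c: "c > 0" using B0 by (simp add: c_def)
    from excess_N have "\<forall>\<^sub>F n in sequentially. (\<Sum>b\<in>Basis. \<integral>v. excess (real n) (v \<bullet> b) \<partial>N) < \<epsilon> / c"
      using \<epsilon> c by (intro order_tendstoD(2)) auto
    from eventually_happens'[OF sequentially_bot this]
    obtain n where n: "(\<Sum>b\<in>Basis. \<integral>v. excess (real n) (v \<bullet> b) \<partial>N) < \<epsilon> / c"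
      by blast
    define E where "E = (\<lambda>v::'b. \<Sum>b\<in>Basis. excess (real n) (v \<bullet> b))"
    have E0: "E v \<ge> 0" for v unfolding E_def by (intro sum_nonneg) (simp add: excess_bounds)
    have [measurable]: "E \<in> borel_measurable borel" unfolding E_def by measurable
    have Elim: "(\<lambda>m. \<integral>\<omega>. E (V m \<omega>) \<partial>M) \<longlonglongrightarrow> (\<integral>v. E v \<partial>N)"
    proof -
      have "integrable M (\<lambda>\<omega>. excess n (V m \<omega> \<bullet> b))" "integrable N (\<lambda>v. excess n (v \<bullet> b))" for m b
        by (auto intro!: M.integrable_const_bound[of _ 1] N.integrable_const_bound[of _ 1]
            simp: excess_bounds)
      then show ?thesis unfolding E_def using tight by (simp add: tendsto_sum)
    qed
    have EN: "(\<integral>v. E v \<partial>N) < \<epsilon> / c"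
      unfolding E_def by (subst Bochner_Integration.integral_sum)
        (use n in \<open>auto intro!: N.integrable_const_bound[of _ 1] simp: excess_bounds\<close>)
    obtain F where F: "trig_poly (\<lambda>x. complex_of_real (F x))" "\<And>x. \<bar>F x\<bar> \<le> B + \<epsilon>"
      "\<And>x. (\<And>b. b \<in> Basis \<Longrightarrow> \<bar>x \<bullet> b\<bar> \<le> real n + 1) \<Longrightarrow> \<bar>h x - F x\<bar> \<le> \<epsilon>"
      using trig_poly_approx_on_box[OF h B, of "real n + 1" \<epsilon>] \<epsilon> by auto
    have "continuous_on UNIV (\<lambda>x. Re (complex_of_real (F x)))"
      using continuous_trig_poly[OF F(1)] by (rule continuous_on_Re)
    then have [measurable]: "F \<in> borel_measurable borel"
      by (auto intro!: borel_measurable_continuous_onI)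
    have hF: "\<bar>h x - F x\<bar> \<le> \<epsilon> + c * E x" for x
    proof (cases "\<forall>b\<in>Basis. \<bar>x \<bullet> b\<bar> \<le> real n + 1")
      case True
      then have "\<bar>h x - F x\<bar> \<le> \<epsilon>" by (intro F(3)) auto
      then show ?thesis using c E0[of x] by (simp add: add_increasing2)
    next
      case False
      then obtain b where b: "b \<in> Basis" "\<bar>x \<bullet> b\<bar> > real n + 1" by force
      have "E x \<ge> excess (real n) (x \<bullet> b)"
        unfolding E_def by (rule member_le_sum) (use b in \<open>auto simp: excess_bounds\<close>)
      then have "E x \<ge> 1" using b by (simp add: excess_bounds)
      then have "c * E x \<ge> c * 1" using c by (intro mult_left_mono) auto
      moreover have "\<bar>h x - F x\<bar> \<le> 2 * B + \<epsilon>" using B[of x] F(2)[of x] by linarith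
      ultimately show ?thesis using \<epsilon> by (simp add: c_def)
    qed
    have diff: "\<bar>(\<integral>\<omega>. h (W \<omega>) \<partial>Q) - (\<integral>\<omega>. F (W \<omega>) \<partial>Q)\<bar> \<le> \<epsilon> + c * (\<integral>\<omega>. E (W \<omega>) \<partial>Q)"
      if "prob_space Q" and W [measurable]: "W \<in> borel_measurable Q" for Q :: "'z measure" and W
    proof -
      interpret Q: prob_space Q by fact
      have I: "integrable Q (\<lambda>\<omega>. h (W \<omega>))" "integrable Q (\<lambda>\<omega>. F (W \<omega>))" "integrable Q (\<lambda>\<omega>. E (W \<omega>))"
      proof -
        show "integrable Q (\<lambda>\<omega>. h (W \<omega>))" using B by (intro Q.integrable_const_bound[of _ B]) auto
        show "integrable Q (\<lambda>\<omega>. F (W \<omega>))" using F by (intro Q.integrable_const_bound[of _ "B + \<epsilon>"]) auto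
        show "integrable Q (\<lambda>\<omega>. E (W \<omega>))" unfolding E_def
          by (intro Bochner_Integration.integrable_sum Q.integrable_const_bound[of _ 1]) (auto simp: excess_bounds)
      qed
      have "\<bar>(\<integral>\<omega>. h (W \<omega>) \<partial>Q) - (\<integral>\<omega>. F (W \<omega>) \<partial>Q)\<bar> = \<bar>\<integral>\<omega>. h (W \<omega>) - F (W \<omega>) \<partial>Q\<bar>"
        using I by simp
      also have "\<dots> \<le> (\<integral>\<omega>. \<bar>h (W \<omega>) - F (W \<omega>)\<bar> \<partial>Q)" by (rule integral_abs_bound)
      also have "\<dots> \<le> (\<integral>\<omega>. \<epsilon> + c * E (W \<omega>) \<partial>Q)"
        using I hF by (intro integral_mono) auto
      also have "\<dots> = \<epsilon> + c * (\<integral>\<omega>. E (W \<omega>) \<partial>Q)" using I by (simp add: Q.prob_space)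
      finally show ?thesis .
    qed
    have "(\<lambda>m. \<integral>\<omega>. F (V m \<omega>) \<partial>M) \<longlonglongrightarrow> (\<integral>v. F v \<partial>N)"
      using tendsto_Re[OF trig[OF F(1)]] by simp
    then have "\<forall>\<^sub>F m in sequentially. \<bar>(\<integral>\<omega>. F (V m \<omega>) \<partial>M) - (\<integral>v. F v \<partial>N)\<bar> < \<epsilon>"
      using \<epsilon> tendstoD by (fastforce simp: dist_real_def)
    moreover have "\<forall>\<^sub>F m in sequentially. (\<integral>\<omega>. E (V m \<omega>) \<partial>M) < \<epsilon> / c"
      using Elim EN by (rule order_tendstoD(2))
    ultimately have "\<forall>\<^sub>F m in sequentially. \<bar>(\<integral>\<omega>. h (V m \<omega>) \<partial>M) - (\<integral>v. h v \<partial>N)\<bar> < r"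
    proof eventually_elim
      case (elim m)
      have "c * (\<integral>\<omega>. E (V m \<omega>) \<partial>M) < \<epsilon>" "c * (\<integral>v. E v \<partial>N) < \<epsilon>"
        using elim(2) EN c by (simp_all add: field_simps)
      then show ?case
        using diff[OF M.prob_space_axioms V[of m]] diff[OF N.prob_space_axioms, of "\<lambda>v. v"] elim(1) \<epsilon>
        by simp
    qed
    then show "\<exists>no. \<forall>m\<ge>no. norm ((\<integral>\<omega>. h (V m \<omega>) \<partial>M) - (\<integral>v. h v \<partial>N)) < r"
      by (simp add: eventually_sequentially)
  qed
qed

section \<open>Normal laws and the construction of the Gaussian limit\<close>

lemma normal_law_eq_distr:
  assumes "\<sigma> \<ge> 0"
  shows "normal_law m \<sigma> = distr std_normal_distribution borel (\<lambda>x. m + \<sigma> * x)"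
proof -
  interpret S: real_distribution std_normal_distribution by (rule real_dist_normal_dist)
  show ?thesis
  \<comment> \<open>The point mass has no density and is treated apart. Afterwards both kinds of law
    are affine images of the standard normal law, from which characteristic function and moments are
    inherited.\<close>
  proof (cases "\<sigma> = 0")
    case True
    then show ?thesis by (simp add: normal_law_def S.distr_const)
  next
    case False
    have "distributed std_normal_distribution lborel (\<lambda>x. x) std_normal_density"
      unfolding distributed_def by (auto simp: distr_id2)
    then have "distributed std_normal_distribution lborel (\<lambda>x. m + \<sigma> * x)
        (normal_density (m + \<sigma> * 0) (\<bar>\<sigma>\<bar> * 1))"
      using False by (intro S.normal_density_affine) auto
    then have "distr std_normal_distribution lborel (\<lambda>x. m + \<sigma> * x) = density lborel (normal_density m \<sigma>)"
      using assms by (simp add: distributed_distr_eq_density)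
    moreover have "distr std_normal_distribution lborel (\<lambda>x. m + \<sigma> * x)
        = distr std_normal_distribution borel (\<lambda>x. m + \<sigma> * x)"
      by (intro distr_cong) auto
    ultimately show ?thesis using False by (simp add: normal_law_def)
  qed
qed

lemma char_normal_law:
  assumes "\<sigma> \<ge> 0"
  shows "char (normal_law 0 \<sigma>) u = complex_of_real (exp (- (\<sigma> * u)\<^sup>2 / 2))"
proof -
  have "char (normal_law 0 \<sigma>) u = char std_normal_distribution (\<sigma> * u)"
    unfolding normal_law_eq_distr[OF assms] char_def by (subst integral_distr) (auto simp: ac_simps)
  then show ?thesis by (simp add: char_std_normal_distribution)
qed

lemma real_distribution_normal_law: "\<sigma> \<ge> 0 \<Longrightarrow> real_distribution (normal_law m \<sigma>)"
  using prob_space.real_distribution_distr[OF prob_space_normal_density[of 1 0]]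
  by (simp add: normal_law_eq_distr)

lemma normal_law_moments:
  assumes "\<sigma> \<ge> 0"
  shows "integrable (normal_law 0 \<sigma>) (\<lambda>x. x)" "(\<integral>x. x \<partial>normal_law 0 \<sigma>) = 0"
    and "integrable (normal_law 0 \<sigma>) (\<lambda>x. x\<^sup>2)" "(\<integral>x. x\<^sup>2 \<partial>normal_law 0 \<sigma>) = \<sigma>\<^sup>2"
proof -
  have I1: "integrable std_normal_distribution (\<lambda>x. x)" "(\<integral>x. x \<partial>std_normal_distribution) = 0"
    using integrable_std_normal_distribution_moment[of 1] integral_std_normal_distribution_moment_odd[of 1]
    by simp_all
  have I2: "integrable std_normal_distribution (\<lambda>x. x\<^sup>2)" "(\<integral>x. x\<^sup>2 \<partial>std_normal_distribution) = 1"
    using integrable_std_normal_distribution_moment[of 2] std_normal_distribution_even_moments(1)[of 1]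
    by (simp_all only: mult_1_right) (simp add: fact_numeral)
  note eq = normal_law_eq_distr[OF assms, of 0, unfolded add_0]
  show "integrable (normal_law 0 \<sigma>) (\<lambda>x. x)"
    unfolding eq by (rule integrable_distr_eq[THEN iffD2])
      (simp_all add: I1)
  show "(\<integral>x. x \<partial>normal_law 0 \<sigma>) = 0"
    unfolding eq by (subst integral_distr) (simp_all add: I1)
  show "integrable (normal_law 0 \<sigma>) (\<lambda>x. x\<^sup>2)"
    unfolding eq
    by (rule integrable_distr_eq[THEN iffD2])
      (simp_all add: power_mult_distrib I2)
  show "(\<integral>x. x\<^sup>2 \<partial>normal_law 0 \<sigma>) = \<sigma>\<^sup>2"
    unfolding eq by (subst integral_distr) (simp_all add: I2 power_mult_distrib)
qed

text \<open>Symmetric elimination, as in a Cholesky decomposition. A positive pivot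
  \<open>K s s\<close> gives the rank-one term to subtract, and the remaining Schur complement is
  again positive semidefinite and supported on \<open>S\<close>. A zero pivot forces its whole row
  to vanish, so nothing is subtracted. The set \<open>S\<close> records the indices not yet
  eliminated.\<close>

lemma psd_factorization:
  fixes K :: "'q::finite \<Rightarrow> 'q \<Rightarrow> real"
  assumes "finite S" and "\<And>i j. K i j = K j i"
    and "\<And>t. (\<Sum>i\<in>UNIV. \<Sum>j\<in>UNIV. t i * t j * K i j) \<ge> 0"
    and "\<And>i j. i \<notin> S \<Longrightarrow> K i j = 0"
  shows "\<exists>a :: 'q \<Rightarrow> 'q \<Rightarrow> real. \<forall>i j. K i j = (\<Sum>l\<in>S. a l i * a l j)"
  using assms
proof (induction S arbitrary: K)
  case empty
  then show ?case by simp
next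
  case (insert s S)
  define Q where "Q = (\<lambda>(K :: 'q \<Rightarrow> 'q \<Rightarrow> real) t. \<Sum>i\<in>UNIV. \<Sum>j\<in>UNIV. t i * t j * K i j)"
  define L where "L = (\<lambda>t. \<Sum>j\<in>UNIV. t j * K s j)"
  note sym = insert.prems(1)
  \<comment> \<open>Along one coordinate direction the form is a quadratic polynomial in x. Its
    nonnegativity for all x drives both the zero and the positive pivot case.\<close>
  have Q_shift: "Q K (\<lambda>i. t i + x * of_bool (i = s)) = Q K t + 2 * x * L t + x\<^sup>2 * K s s" for t x
  proof -
    have "Q K (\<lambda>i. t i + x * of_bool (i = s)) = (\<Sum>i\<in>UNIV. \<Sum>j\<in>UNIV. t i * t j * K i j
        + x * t i * K i j * of_bool (j = s) + x * t j * K i j * of_bool (i = s)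
        + x * x * K i j * of_bool (j = s) * of_bool (i = s))"
      unfolding Q_def by (intro sum.cong refl) (simp add: algebra_simps)
    also have "\<dots> = Q K t
        + (\<Sum>i\<in>UNIV. \<Sum>j\<in>UNIV. x * t i * K i j * of_bool (j = s))
        + (\<Sum>i\<in>UNIV. (\<Sum>j\<in>UNIV. x * t j * K i j) * of_bool (i = s))
        + (\<Sum>i\<in>UNIV. (\<Sum>j\<in>UNIV. x * x * K i j * of_bool (j = s)) * of_bool (i = s))"
      unfolding Q_def sum_distrib_right sum.distrib ..
    also have "\<dots> = Q K t + x * L t + x * L t + x\<^sup>2 * K s s"
    proof -
      have "(\<Sum>i\<in>UNIV. x * t i * K i s) = x * L t"
        unfolding L_def sum_distrib_left
      proof (rule sum.cong[OF refl])
        show "x * t i * K i s = x * (t i * K s i)" for i using sym[of i s] by simp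
      qed
      moreover have "(\<Sum>j\<in>UNIV. x * t j * K s j) = x * L t"
        unfolding L_def sum_distrib_left by (simp add: mult.assoc)
      ultimately show ?thesis by (simp add: power2_eq_square)
    qed
    finally show ?thesis by simp
  qed
  have Q_nonneg: "Q K t \<ge> 0" for t using insert.prems(2) by (simp add: Q_def)
  show ?case
  proof (cases "K s s = 0")
    case True
    have "K s i = 0" for i
    proof (rule ccontr)
      assume ne: "K s i \<noteq> 0"
      define t where "t = (\<lambda>j. of_bool (j = i) :: real)"
      have "L t = K s i" unfolding L_def t_def by simp
      \<comment> \<open>With a zero pivot the polynomial is affine in x with slope
        \<open>2 * K s i\<close>, and this x is the point where it takes the value -1.\<close>
      then have "Q K (\<lambda>j. t j + (- (Q K t + 1) / (2 * K s i)) * of_bool (j = s)) = - 1"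
        unfolding Q_shift using True ne by (simp add: field_simps)
      then show False using Q_nonneg[of "\<lambda>j. t j + (- (Q K t + 1) / (2 * K s i)) * of_bool (j = s)"]
        by simp
    qed
    then have "\<And>i j. i \<notin> S \<Longrightarrow> K i j = 0" using insert.prems(3) by (case_tac "i = s") auto
    then obtain a where a: "\<And>i j. K i j = (\<Sum>l\<in>S. a l i * a l j)"
      using insert.IH[of K] insert.prems by blast
    define a' where "a' = a(s := \<lambda>_. 0)"
    have "(\<Sum>l\<in>insert s S. a' l i * a' l j) = (\<Sum>l\<in>S. a l i * a l j)" for i j
    proof -
      have "(\<Sum>l\<in>S. a' l i * a' l j) = (\<Sum>l\<in>S. a l i * a l j)"
        by (intro sum.cong) (use insert.hyps in \<open>auto simp: a'_def\<close>)
      then show ?thesis using insert.hyps by (simp add: a'_def)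
    qed
    then show ?thesis using a by metis
  next
    case False
    define k where "k = K s s"
    have "k \<ge> 0" using Q_nonneg[of "\<lambda>i. 0 + 1 * of_bool (i = s)"] unfolding Q_shift
      by (simp add: Q_def L_def k_def)
    then have k: "k > 0" using False by (simp add: k_def)
    define K' where "K' = (\<lambda>i j. K i j - K s i * K s j / k)"
    have "Q K' t \<ge> 0" for t
    proof -
      have "Q K' t = Q K t - (\<Sum>i\<in>UNIV. \<Sum>j\<in>UNIV. (t i * K s i) * (t j * K s j)) / k"
        unfolding Q_def K'_def
        by (simp add: sum_subtractf[symmetric] sum_divide_distrib algebra_simps)
      also have "\<dots> = Q K t - (L t)\<^sup>2 / k"
        unfolding L_def power2_eq_square sum_product ..
      \<comment> \<open>The shift - L t / k minimizes the quadratic polynomial, and the minimum is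
        the value of the Schur complement at t.\<close>
      also have "\<dots> = Q K (\<lambda>i. t i + (- L t / k) * of_bool (i = s))"
        unfolding Q_shift using k by (simp add: k_def[symmetric] power2_eq_square field_simps)
      finally show ?thesis using Q_nonneg by simp
    qed
    moreover have "K' i j = 0" if "i \<notin> S" for i j
      using that k insert.prems(3)[of i] sym[of s i] by (cases "i = s") (auto simp: K'_def k_def)
    moreover have "K' i j = K' j i" for i j using sym by (simp add: K'_def)
    ultimately obtain a where a: "\<And>i j. K' i j = (\<Sum>l\<in>S. a l i * a l j)"
      using insert.IH[of K'] unfolding Q_def by blast
    define a' where "a' = a(s := \<lambda>i. K s i / sqrt k)"
    have "(\<Sum>l\<in>insert s S. a' l i * a' l j) = K i j" for i j
    proof -
      have "(\<Sum>l\<in>S. a' l i * a' l j) = (\<Sum>l\<in>S. a l i * a l j)"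
        by (intro sum.cong) (use insert.hyps in \<open>auto simp: a'_def\<close>)
      then show ?thesis using insert.hyps k by (simp add: a'_def a[symmetric] K'_def)
    qed
    then show ?thesis by metis
  qed
qed

text \<open>A factorization of \<open>K\<close> maps independent standard normals linearly to a
  vector with covariance \<open>K\<close>. Each projection is then a linear combination of the
  normals; its characteristic function is a product, and Levy uniqueness identifies the law even
  when the variance is 0.\<close>

lemma exists_gaussian_projections:
  fixes K :: "'q::finite \<Rightarrow> 'q \<Rightarrow> real"
  assumes sym: "\<And>i j. K i j = K j i"
    and psd: "\<And>t. (\<Sum>i\<in>UNIV. \<Sum>j\<in>UNIV. t i * t j * K i j) \<ge> 0"
  obtains N :: "(real ^ 'q) measure" where "prob_space N" "sets N = sets borel"
    "\<And>t. distr N borel (\<lambda>v. t \<bullet> v)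
      = normal_law 0 (sqrt (\<Sum>i\<in>UNIV. \<Sum>j\<in>UNIV. t $ i * t $ j * K i j))"
proof -
  have "\<exists>a :: 'q \<Rightarrow> 'q \<Rightarrow> real. \<forall>i j. K i j = (\<Sum>l\<in>UNIV. a l i * a l j)"
    by (rule psd_factorization[OF _ sym psd]) auto
  then obtain a :: "'q \<Rightarrow> 'q \<Rightarrow> real" where a: "\<And>i j. K i j = (\<Sum>l\<in>UNIV. a l i * a l j)"
    by blast
  define Z where "Z = (\<Pi>\<^sub>M l\<in>(UNIV::'q set). std_normal_distribution)"
  interpret Z: product_prob_space "\<lambda>_. std_normal_distribution" "UNIV :: 'q set"
    by unfold_locales (use prob_space_normal_density[of 1 0] in
        \<open>auto simp: prob_space_def prob_space_axioms_def finite_measure_def finite_measure_axioms_def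
          sigma_finite_measure_def\<close>)
  have [measurable_cong]: "sets Z = sets (\<Pi>\<^sub>M l\<in>(UNIV::'q set). borel)"
    unfolding Z_def by (intro sets_PiM_cong) auto
  define T where "T = (\<lambda>z::'q \<Rightarrow> real. \<chi> i. \<Sum>l\<in>UNIV. a l i * z l)"
  have [measurable]: "T \<in> borel_measurable Z"
    unfolding T_def by (subst borel_measurable_euclidean_space) (auto simp: Basis_vec_def inner_axis)
  show ?thesis
  proof
    interpret ZP: prob_space Z
      unfolding Z_def by (intro prob_space_PiM prob_space_normal_density) simp
    show "prob_space (distr Z borel T)" by (rule ZP.prob_space_distr) simp
    show "sets (distr Z borel T) = sets borel" by simp
    fix t :: "real ^ 'q"
    define \<sigma>2 where "\<sigma>2 = (\<Sum>i\<in>UNIV. \<Sum>j\<in>UNIV. t $ i * t $ j * K i j)"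
    have \<sigma>2_nonneg: "\<sigma>2 \<ge> 0" using psd by (simp add: \<sigma>2_def)
    define c where "c = (\<lambda>l. \<Sum>i\<in>UNIV. t $ i * a l i)"
    have tT: "t \<bullet> T z = (\<Sum>l\<in>UNIV. c l * z l)" for z
      unfolding T_def c_def inner_vec_def
      by (simp add: sum_distrib_left sum_distrib_right mult.assoc) (rule sum.swap)
    have c2: "(\<Sum>l\<in>UNIV. (c l)\<^sup>2) = \<sigma>2"
    proof -
      have "\<sigma>2 = (\<Sum>i\<in>UNIV. \<Sum>j\<in>UNIV. \<Sum>l\<in>UNIV. (t $ i * a l i) * (t $ j * a l j))"
        unfolding \<sigma>2_def a by (simp add: sum_distrib_left mult.assoc mult.left_commute)
      also have "\<dots> = (\<Sum>l\<in>UNIV. \<Sum>i\<in>UNIV. \<Sum>j\<in>UNIV. (t $ i * a l i) * (t $ j * a l j))"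
        by (subst sum.swap[of _ "UNIV :: 'q set"], subst (2) sum.swap) (rule refl)
      finally show ?thesis by (simp add: c_def power2_eq_square sum_product)
    qed
    have eq: "distr (distr Z borel T) borel (\<lambda>v. t \<bullet> v) = distr Z borel (\<lambda>z. t \<bullet> T z)"
      by (subst distr_distr) (auto simp: comp_def)
    have "distr Z borel (\<lambda>z. t \<bullet> T z) = normal_law 0 (sqrt \<sigma>2)"
    proof (rule Levy_uniqueness)
      show "real_distribution (distr Z borel (\<lambda>z. t \<bullet> T z))"
        by (rule ZP.real_distribution_distr) simp
      show "real_distribution (normal_law 0 (sqrt \<sigma>2))"
        by (rule real_distribution_normal_law) (simp add: \<sigma>2_def psd)
      show "char (distr Z borel (\<lambda>z. t \<bullet> T z)) = char (normal_law 0 (sqrt \<sigma>2))"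
      proof
        fix u
        have "char (distr Z borel (\<lambda>z. t \<bullet> T z)) u = (\<integral>z. iexp (u * (t \<bullet> T z)) \<partial>Z)"
          unfolding char_def by (subst integral_distr) auto
        also have "\<dots> = (\<integral>z. (\<Prod>l\<in>UNIV. iexp ((u * c l) * z l)) \<partial>Z)"
          unfolding tT by (simp add: exp_sum[symmetric] sum_distrib_left mult.assoc)
        also have "\<dots> = (\<Prod>l\<in>UNIV. char std_normal_distribution (u * c l))"
          unfolding Z_def char_def
        proof (rule Z.product_integral_prod)
          have fin: "finite_measure std_normal_distribution"
            by (intro prob_space.finite_measure prob_space_normal_density) simp
          show "integrable std_normal_distribution (\<lambda>x. iexp (u * c l * x))" for l
            by (rule finite_measure.integrable_const_bound[OF fin, of _ 1]) auto
        qed simp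
        also have "\<dots> = exp (\<Sum>l\<in>UNIV. complex_of_real (- (u * c l)\<^sup>2 / 2))"
          unfolding char_std_normal_distribution exp_of_real[symmetric]
          by (simp add: exp_sum)
        also have "(\<Sum>l\<in>UNIV. complex_of_real (- (u * c l)\<^sup>2 / 2)) = complex_of_real (- u\<^sup>2 * \<sigma>2 / 2)"
          by (simp add: c2[symmetric] sum_distrib_left power_mult_distrib sum_negf sum_divide_distrib)
        also have "exp \<dots> = char (normal_law 0 (sqrt \<sigma>2)) u"
          unfolding exp_of_real
          using \<sigma>2_nonneg by (subst char_normal_law) (auto simp: power_mult_distrib mult.commute)
        finally show "char (distr Z borel (\<lambda>z. t \<bullet> T z)) u = char (normal_law 0 (sqrt \<sigma>2)) u" .
      qed
    qed
    then show "distr (distr Z borel T) borel (\<lambda>v. t \<bullet> v)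
      = normal_law 0 (sqrt (\<Sum>i\<in>UNIV. \<Sum>j\<in>UNIV. t $ i * t $ j * K i j))"
      unfolding eq by (simp add: \<sigma>2_def)
  qed
qed

text \<open>Everything is read off the one-dimensional projections: means along the axes, the
  characteristic function at argument 1, and covariances by polarization from the second moments
  along the sum and the difference of two axis vectors.\<close>

lemma gaussian_with_projections:
  fixes K :: "'q::finite \<Rightarrow> 'q \<Rightarrow> real" and N :: "(real ^ 'q) measure"
  assumes sym: "\<And>i j. K i j = K j i"
    and psd: "\<And>t. (\<Sum>i\<in>UNIV. \<Sum>j\<in>UNIV. t i * t j * K i j) \<ge> 0"
    and N: "prob_space N" "sets N = sets borel"
    and proj: "\<And>t. distr N borel (\<lambda>v. t \<bullet> v)
      = normal_law 0 (sqrt (\<Sum>i\<in>UNIV. \<Sum>j\<in>UNIV. t $ i * t $ j * K i j))"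
  shows "centred_gaussian_with_cov N K"
    and "(\<integral>v. iexp (t \<bullet> v) \<partial>N)
      = complex_of_real (exp (- (\<Sum>i\<in>UNIV. \<Sum>j\<in>UNIV. t $ i * t $ j * K i j) / 2))"
proof -
  interpret prob_space N by fact
  have [measurable_cong]: "sets N = sets borel" by fact
  define Q where "Q = (\<lambda>t :: real ^ 'q. \<Sum>i\<in>UNIV. \<Sum>j\<in>UNIV. t $ i * t $ j * K i j)"
  have Q: "Q t \<ge> 0" for t using psd by (simp add: Q_def)
  have proj: "distr N borel (\<lambda>v. t \<bullet> v) = normal_law 0 (sqrt (Q t))" for t
    using proj by (simp add: Q_def)
  have sqQ: "sqrt (Q t) \<ge> 0" for t using Q by simp
  have 1: "integrable N (\<lambda>v. t \<bullet> v)" "(\<integral>v. t \<bullet> v \<partial>N) = 0"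
    and 2: "integrable N (\<lambda>v. (t \<bullet> v)\<^sup>2)" "(\<integral>v. (t \<bullet> v)\<^sup>2 \<partial>N) = Q t" for t
    using normal_law_moments[OF sqQ[of t]] Q[of t]
    by (simp_all add: proj[symmetric] integrable_distr_eq integral_distr)
  have coord: "v $ i = axis i 1 \<bullet> v" for v :: "real ^ 'q" and i
    by (simp add: inner_axis')
  have cov: "(\<integral>v. v $ i * v $ j \<partial>N) = K i j" for i j
  proof -
    let ?p = "axis i 1 + axis j 1 :: real ^ 'q" and ?m = "axis i 1 - axis j 1 :: real ^ 'q"
    have "(\<integral>v. v $ i * v $ j \<partial>N) = (\<integral>v. ((?p \<bullet> v)\<^sup>2 - (?m \<bullet> v)\<^sup>2) / 4 \<partial>N)"
      by (intro Bochner_Integration.integral_cong)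
        (auto simp: coord inner_add_left inner_diff_left power2_eq_square algebra_simps)
    also have "\<dots> = (Q ?p - Q ?m) / 4" using 2 by simp
    also have "\<dots> = K i j"
    proof -
      have "Q ?p - Q ?m = (\<Sum>k\<in>UNIV. \<Sum>l\<in>UNIV. 2 * K k l * (of_bool (k = i) * of_bool (l = j)
          + of_bool (k = j) * of_bool (l = i)))"
        unfolding Q_def sum_subtractf[symmetric]
        by (intro sum.cong refl) (auto simp: axis_def algebra_simps)
      also have "\<dots> = 2 * K i j + 2 * K j i"
        by (simp add: distrib_left sum.distrib mult.assoc[symmetric] sum_distrib_right[symmetric])
      finally show ?thesis using sym[of i j] by simp
    qed
    finally show ?thesis .
  qed
  have mean: "(\<integral>v. v $ i \<partial>N) = 0" for i unfolding coord by (rule 1)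
  show "centred_gaussian_with_cov N K"
    unfolding centred_gaussian_with_cov_def gaussian_measure_def covariance_def
    using N mean cov proj sqQ by (simp del: real_sqrt_ge_0_iff) blast
  have "(\<integral>v. iexp (t \<bullet> v) \<partial>N) = char (distr N borel (\<lambda>v. t \<bullet> v)) 1"
    unfolding char_def by (subst integral_distr) auto
  then show "(\<integral>v. iexp (t \<bullet> v) \<partial>N)
      = complex_of_real (exp (- (\<Sum>i\<in>UNIV. \<Sum>j\<in>UNIV. t $ i * t $ j * K i j) / 2))"
    using Q[of t] sqQ[of t] by (simp add: proj char_normal_law Q_def)
qed

subsection \<open>The joint law of the past and the next point\<close>

text \<open>The past enters as a set, so a point that repeats an earlier one is not counted again;
  the second condition under \<open>of_bool\<close> accounts for this.\<close>

lemma neighbour_count_image_Suc: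
  "neighbour_count R u (y ` {1..Suc k}) = neighbour_count R u (y ` {1..k}) +
     of_bool (dist u (y (Suc k)) \<le> R u \<and> y (Suc k) \<notin> y ` {1..k})"
proof -
  have "{z \<in> y ` {1..Suc k}. dist u z \<le> R u} =
      (if dist u (y (Suc k)) \<le> R u then insert (y (Suc k)) {z \<in> y ` {1..k}. dist u z \<le> R u}
       else {z \<in> y ` {1..k}. dist u z \<le> R u})"
    by (auto simp: atLeastAtMostSuc_conv)
  then show ?thesis unfolding neighbour_count_def by (simp add: card_insert_if)
qed

lemma neighbour_count_image_le: "neighbour_count R u (y ` {1..k}) \<le> k"
proof (induction k)
  case 0
  then show ?case by (simp add: neighbour_count_def)
next
  case (Suc k)
  then show ?case unfolding neighbour_count_image_Suc by (simp add: of_bool_def)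
qed

text \<open>The recursion in \<open>k\<close> writes the cardinality of the random set as a finite
  sum of indicators of measurable events, including the events that points coincide.\<close>

lemma measurable_neighbour_count:
  fixes U :: "'c \<Rightarrow> 'a::euclidean_space" and k :: nat
  assumes "U \<in> borel_measurable N" "(\<lambda>w. R (U w)) \<in> borel_measurable N"
    and "\<And>i. i \<in> {1..k} \<Longrightarrow> Y i \<in> borel_measurable N"
  shows "(\<lambda>w. neighbour_count R (U w) ((\<lambda>i. Y i w) ` {1..k})) \<in> N \<rightarrow>\<^sub>M count_space UNIV"
  using assms(3)
proof (induction k)
  case 0
  then show ?case by (simp add: neighbour_count_def)
next
  case (Suc k)
  note [measurable] = assms(1,2)
  have [measurable]: "Y (Suc k) \<in> borel_measurable N" using Suc.prems by simp
  have Y [measurable]: "Y i \<in> borel_measurable N" if "i \<in> {1..k}" for i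
    using Suc.prems that by simp
  have [measurable]: "(\<lambda>w. neighbour_count R (U w) ((\<lambda>i. Y i w) ` {1..k})) \<in> N \<rightarrow>\<^sub>M count_space UNIV"
    using Suc by simp
  have [measurable]: "Measurable.pred N (\<lambda>w. \<forall>i\<in>{1..k}. Y (Suc k) w \<noteq> Y i w)"
    by (intro pred_intros_finite) (use Y in \<open>auto intro!: borel_measurable_eq\<close>)
  have "(\<lambda>w. neighbour_count R (U w) ((\<lambda>i. Y i w) ` {1..k}) +
     of_bool (dist (U w) (Y (Suc k) w) \<le> R (U w) \<and> (\<forall>i\<in>{1..k}. Y (Suc k) w \<noteq> Y i w)))
     \<in> N \<rightarrow>\<^sub>M count_space UNIV"
    unfolding of_bool_def by measurable
  moreover have "Y (Suc k) w \<notin> (\<lambda>i. Y i w) ` {1..k} \<longleftrightarrow> (\<forall>i\<in>{1..k}. Y (Suc k) w \<noteq> Y i w)" for w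
    by blast
  ultimately show ?case by (simp only: neighbour_count_image_Suc)
qed

section \<open>Standing assumptions with explicit constants, and bounds that hold for every
  past\<close>

locale local_interaction = prob_space M for M :: "'w measure" +
  fixes D :: "'a::euclidean_space set" and R :: "'a \<Rightarrow> real" and \<beta>s :: "nat \<Rightarrow> 'a \<Rightarrow> real"
    and \<beta> :: "'a \<Rightarrow> real" and C b r0 :: real and X :: "nat \<Rightarrow> 'w \<Rightarrow> 'a"
  assumes D_compact: "compact D" and D_pos: "measure lborel D > 0"
    and R_meas: "R \<in> borel_measurable (restrict_space borel D)"
    and r0: "r0 > 0" "\<And>x. x \<in> D \<Longrightarrow> r0 \<le> R x"
    and \<beta>s_meas: "\<And>n. \<beta>s n \<in> borel_measurable (restrict_space borel D)"
    and \<beta>s_pos: "\<And>n x. x \<in> D \<Longrightarrow> \<beta>s n x > 0"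
    and \<beta>s_le: "\<And>n x. x \<in> D \<Longrightarrow> \<beta>s n x \<le> C"
    and \<beta>_meas: "\<beta> \<in> borel_measurable (restrict_space borel D)"
    and b: "b > 0" "\<And>x. x \<in> D \<Longrightarrow> b \<le> \<beta> x" and \<beta>_le: "\<And>x. x \<in> D \<Longrightarrow> \<beta> x \<le> C"
    and \<beta>s_lim: "uniform_limit D \<beta>s \<beta> sequentially"
    and X_process: "sequential_point_process M D R \<beta>s X"
begin

declare One_nat_def [simp del]

definition L :: "'a measure" where "L = restrict_space lborel D"

lemma D_borel [measurable, simp]: "D \<in> sets borel"
  using D_compact by (simp add: borel_compact)

lemma space_L [simp]: "space L = D"
  by (simp add: L_def space_restrict_space)

lemma sets_L: "sets L = sets (restrict_space borel D)"
  unfolding L_def by (intro sets_restrict_space_cong) simp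

lemma measurable_L_iff: "f \<in> L \<rightarrow>\<^sub>M N \<longleftrightarrow> f \<in> restrict_space borel D \<rightarrow>\<^sub>M N"
  by (simp add: measurable_cong_sets[OF sets_L refl])

lemma measurable_restrict_D_iff: "f \<in> N \<rightarrow>\<^sub>M restrict_space borel D \<longleftrightarrow> f \<in> N \<rightarrow>\<^sub>M L"
  by (simp add: measurable_cong_sets[OF refl sets_L])

lemma emeasure_L: "A \<in> sets L \<Longrightarrow> emeasure L A = emeasure lborel A"
  unfolding L_def by (subst emeasure_restrict_space) (auto simp: sets_restrict_space)

lemma finite_measure_L: "finite_measure L"
proof (rule finite_measureI)
  have "emeasure L (space L) = emeasure lborel D"
    using emeasure_L[of D] sets.top[of L] by simp
  then show "emeasure L (space L) \<noteq> \<infinity>"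
    using emeasure_compact_finite[OF D_compact] by simp
qed

sublocale L: finite_measure L by (rule finite_measure_L)

lemma L_mass: "measure L D = measure lborel D"
  using emeasure_L[of D] sets.top[of L] by (simp add: measure_def)

lemma set_integral_L:
  fixes f :: "'a \<Rightarrow> real"
  assumes "A \<in> sets L"
  shows "(LINT x:A|lborel. f x) = (\<integral>x. indicator A x * f x \<partial>L)"
proof -
  have "A \<subseteq> D" using sets.sets_into_space[OF assms] by simp
  then show ?thesis
    unfolding L_def set_lebesgue_integral_def
    by (subst integral_restrict_space) (auto intro!: Bochner_Integration.integral_cong simp: indicator_def)
qed

lemma set_integral_D: "(LINT x:D|lborel. f x) = (\<integral>x. f x \<partial>L)" for f :: "'a \<Rightarrow> real"
proof -
  have "(LINT x:D|lborel. f x) = (\<integral>x. indicator D x * f x \<partial>L)"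
    using set_integral_L[of D f] sets.top[of L] by simp
  also have "\<dots> = (\<integral>x. f x \<partial>L)"
    by (intro Bochner_Integration.integral_cong) auto
  finally show ?thesis .
qed

lemma ident_measurable [measurable]: "(\<lambda>x. x) \<in> L \<rightarrow>\<^sub>M borel"
  unfolding measurable_L_iff by (rule measurable_restrict_space1) simp

lemma R_measurable [measurable]: "R \<in> borel_measurable L"
  and \<beta>s_measurable [measurable]: "\<beta>s n \<in> borel_measurable L"
  and \<beta>_measurable [measurable]: "\<beta> \<in> borel_measurable L"
  using R_meas \<beta>s_meas \<beta>_meas by (simp_all add: measurable_L_iff)

lemma X_measurable [measurable]: "X (Suc k) \<in> M \<rightarrow>\<^sub>M L"
  using X_process by (simp add: sequential_point_process_def measurable_restrict_D_iff)

lemma X_in_D: "\<omega> \<in> space M \<Longrightarrow> X (Suc k) \<omega> \<in> D"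
  using measurable_space[OF X_measurable[of k]] by simp

lemma X_measurable': "i \<in> {1..k} \<Longrightarrow> X i \<in> M \<rightarrow>\<^sub>M L"
  using X_measurable[of "i - 1"] by simp

lemma C_pos: "C > 0"
proof -
  have "D \<noteq> {}" using D_pos by auto
  then show ?thesis using b \<beta>_le by force
qed

text \<open>A minorant of all intensities at once, hence of the one selected by any past. It is
  positive at each point but may come arbitrarily close to 0 on D, which is why it is used through
  its integrals.\<close>

definition lower :: "'a \<Rightarrow> real" where "lower x = (INF n. \<beta>s n x)"

lemma bdd_below_\<beta>s: "x \<in> D \<Longrightarrow> bdd_below (range (\<lambda>n. \<beta>s n x))"
  using \<beta>s_pos by (intro bdd_belowI[of _ 0]) (auto simp: less_imp_le)

lemma lower_measurable [measurable]: "lower \<in> borel_measurable L"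
  unfolding lower_def by (rule borel_measurable_cINF) (auto simp: bdd_below_\<beta>s)

lemma lower_le: "x \<in> D \<Longrightarrow> lower x \<le> \<beta>s n x"
  unfolding lower_def by (rule cINF_lower) (auto simp: bdd_below_\<beta>s)

text \<open>Positivity of every \<open>\<beta>s n\<close> is only pointwise for small \<open>n\<close>; uniform convergence takes
  care of the tail.\<close>

lemma lower_pos:
  assumes x: "x \<in> D"
  shows "lower x > 0"
proof -
  from uniform_limitD[OF \<beta>s_lim, of "b / 2"] b
  obtain n0 where n0: "\<And>n. n \<ge> n0 \<Longrightarrow> dist (\<beta>s n x) (\<beta> x) < b / 2"
    using x by (auto simp: eventually_sequentially)
  define m where "m = min (b / 2) (Min ((\<lambda>n. \<beta>s n x) ` {..n0}))"
  have "m > 0" using b \<beta>s_pos[OF x] by (auto simp: m_def)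
  moreover have "m \<le> lower x"
    unfolding lower_def
  proof (rule cINF_greatest)
    fix n
    show "m \<le> \<beta>s n x"
    proof (cases "n \<le> n0")
      case True
      then have "Min ((\<lambda>n. \<beta>s n x) ` {..n0}) \<le> \<beta>s n x" by (intro Min_le) auto
      then show ?thesis by (simp add: m_def)
    next
      case False
      then have "dist (\<beta>s n x) (\<beta> x) < b / 2" using n0 by simp
      then have "b / 2 \<le> \<beta>s n x" using b(2)[OF x] unfolding dist_real_def by linarith
      then show ?thesis by (simp add: m_def min_le_iff_disj)
    qed
  qed simp
  ultimately show ?thesis by simp
qed

lemma integrable_lower: "integrable L lower"
proof (rule L.integrable_const_bound[of _ C])
  show "AE x in L. norm (lower x) \<le> C"
  proof (rule AE_I2)
    fix x assume "x \<in> space L"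
    then show "norm (lower x) \<le> C"
      using lower_pos[of x] lower_le[of x 0] \<beta>s_le[of x 0] by simp
  qed
qed simp

text \<open>A nonnegative integrand with integral 0 vanishes almost everywhere, whereas this one is
  nonzero at every point of \<open>A\<close>.\<close>

lemma set_integral_lower_pos:
  assumes "A \<in> sets L" "emeasure L A > 0"
  shows "(\<integral>x. indicator A x * lower x \<partial>L) > 0"
proof -
  note assms(1)[measurable]
  have "integrable L (\<lambda>x. indicator A x * lower x)"
    by (intro Bochner_Integration.integrable_bound[OF integrable_lower])
      (auto simp: indicator_def)
  moreover have "AE x in L. indicator A x * lower x \<ge> 0"
    by (intro AE_I2) (simp add: lower_pos less_imp_le)
  moreover have "{x \<in> space L. indicator A x * lower x \<noteq> 0} = A"
    using sets.sets_into_space[OF assms(1)] lower_pos by (force simp: indicator_def)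
  ultimately have "(\<integral>x. indicator A x * lower x \<partial>L) \<noteq> 0"
    using assms integral_nonneg_eq_0_iff_AE[of L "\<lambda>x. indicator A x * lower x"]
    by (auto simp: AE_iff_measurable[OF _ refl])
  moreover have "(\<integral>x. indicator A x * lower x \<partial>L) \<ge> 0"
    by (intro integral_nonneg_AE AE_I2) (simp add: lower_pos less_imp_le)
  ultimately show ?thesis by simp
qed

text \<open>A deterministic lower bound for all normalizers, so that every conditional density is at
  most \<open>C / \<alpha>0\<close>, whatever the past.\<close>

definition \<alpha>0 :: real where "\<alpha>0 = (\<integral>x. lower x \<partial>L)"

lemma \<alpha>0_pos: "\<alpha>0 > 0"
proof -
  have "(\<integral>x. indicator D x * lower x \<partial>L) > 0"
    using D_pos emeasure_L[of D] sets.top[of L]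
    by (intro set_integral_lower_pos) (auto simp: measure_def zero_less_iff_neq_zero)
  also have "(\<integral>x. indicator D x * lower x \<partial>L) = \<alpha>0"
    unfolding \<alpha>0_def by (intro Bochner_Integration.integral_cong) auto
  finally show ?thesis .
qed

section \<open>Conditional densities as functions of the past configuration\<close>

abbreviation "P k \<equiv> (\<Pi>\<^sub>M i\<in>{1..k::nat}. L)"

definition past_points :: "nat \<Rightarrow> 'w \<Rightarrow> nat \<Rightarrow> 'a" where
  "past_points k \<omega> = (\<lambda>i\<in>{1..k}. X i \<omega>)"

lemma past_points_measurable [measurable]: "past_points k \<in> M \<rightarrow>\<^sub>M P k"
  unfolding past_points_def by (rule measurable_restrict) (rule X_measurable')

lemma image_past_points: "past_points k \<omega> ` {1..k} = (\<lambda>i. X i \<omega>) ` {1..k}"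
  unfolding past_points_def by (rule image_cong) auto

definition count :: "nat \<Rightarrow> (nat \<Rightarrow> 'a) \<Rightarrow> 'a \<Rightarrow> nat" where
  "count k y u = neighbour_count R u (y ` {1..k})"

definition \<psi> :: "nat \<Rightarrow> (nat \<Rightarrow> 'a) \<Rightarrow> 'a \<Rightarrow> real" where
  "\<psi> k y = next_density D R \<beta>s (y ` {1..k})"

definition \<alpha>s :: "nat \<Rightarrow> (nat \<Rightarrow> 'a) \<Rightarrow> real" where
  "\<alpha>s k y = (\<integral>u. \<beta>s (count k y u) u \<partial>L)"

lemma \<psi>_eq: "\<psi> k y u = \<beta>s (count k y u) u / \<alpha>s k y"
  by (simp add: \<psi>_def next_density_def \<alpha>s_def normalizer_def set_integral_D count_def)

lemma count_measurable [measurable]: "case_prod (count k) \<in> P k \<Otimes>\<^sub>M L \<rightarrow>\<^sub>M count_space UNIV"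
proof -
  have "(\<lambda>w. neighbour_count R (snd w) ((\<lambda>i. fst w i) ` {1..k})) \<in> P k \<Otimes>\<^sub>M L \<rightarrow>\<^sub>M count_space UNIV"
    by (rule measurable_neighbour_count) measurable
  then show ?thesis by (simp add: count_def case_prod_unfold)
qed

lemma \<beta>s_count_measurable [measurable]:
  "(\<lambda>(y, u). \<beta>s (count k y u) u) \<in> borel_measurable (P k \<Otimes>\<^sub>M L)"
proof -
  have "(\<lambda>w. (\<lambda>n w. \<beta>s n (snd w)) (case_prod (count k) w) w) \<in> borel_measurable (P k \<Otimes>\<^sub>M L)"
    by (rule measurable_compose_countable[OF _ count_measurable]) measurable
  then show ?thesis by (simp add: case_prod_beta)
qed

lemma \<alpha>s_measurable [measurable]: "\<alpha>s k \<in> borel_measurable (P k)"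
  unfolding \<alpha>s_def by (rule L.borel_measurable_lebesgue_integral) measurable

lemma \<psi>_measurable [measurable]: "case_prod (\<psi> k) \<in> borel_measurable (P k \<Otimes>\<^sub>M L)"
proof -
  have "(\<lambda>w. (case w of (y, u) \<Rightarrow> \<beta>s (count k y u) u) / \<alpha>s k (fst w)) \<in> borel_measurable (P k \<Otimes>\<^sub>M L)"
    by measurable
  then show ?thesis by (simp add: \<psi>_eq case_prod_unfold)
qed

lemma measurable_section:
  assumes f: "case_prod f \<in> P k \<Otimes>\<^sub>M L \<rightarrow>\<^sub>M N" and y: "y \<in> space (P k)"
  shows "f y \<in> L \<rightarrow>\<^sub>M N"
  using measurable_compose[OF measurable_Pair1'[OF y] f] by simp

lemma past_points_space: "\<omega> \<in> space M \<Longrightarrow> past_points k \<omega> \<in> space (P k)"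
  by (rule measurable_space[OF past_points_measurable])

lemma integrable_\<beta>s_count: "y \<in> space (P k) \<Longrightarrow> integrable L (\<lambda>u. \<beta>s (count k y u) u)"
  using measurable_section[OF \<beta>s_count_measurable] \<beta>s_pos \<beta>s_le
  by (intro L.integrable_const_bound[of _ C]) (auto simp: less_imp_le)

lemma \<alpha>s_ge: "y \<in> space (P k) \<Longrightarrow> \<alpha>0 \<le> \<alpha>s k y"
  unfolding \<alpha>0_def \<alpha>s_def
  by (intro integral_mono integrable_lower integrable_\<beta>s_count lower_le) auto

lemma \<alpha>s_le: "y \<in> space (P k) \<Longrightarrow> \<alpha>s k y \<le> C * measure L D"
  unfolding \<alpha>s_def
  using integral_mono[OF integrable_\<beta>s_count L.integrable_const[of C]] \<beta>s_le
  by (simp add: mult.commute)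

lemma \<psi>_bounds:
  assumes "y \<in> space (P k)" "u \<in> D"
  shows "0 < \<psi> k y u" "\<psi> k y u \<le> C / \<alpha>0"
  using \<alpha>s_ge[OF assms(1)] \<alpha>0_pos \<beta>s_pos[OF assms(2)] \<beta>s_le[OF assms(2)] C_pos
  unfolding \<psi>_eq by (auto intro!: divide_pos_pos frac_le simp: less_imp_le)

lemma integrable_\<psi>_mult:
  fixes g :: "'a \<Rightarrow> 'b::{banach,second_countable_topology}"
  assumes y: "y \<in> space (P k)" and [measurable]: "g \<in> borel_measurable L"
    and B: "\<And>u. u \<in> D \<Longrightarrow> norm (g u) \<le> B"
  shows "integrable L (\<lambda>u. \<psi> k y u *\<^sub>R g u)"
proof (rule L.integrable_const_bound[of _ "C / \<alpha>0 * B"])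
  have [measurable]: "\<psi> k y \<in> borel_measurable L"
    by (rule measurable_section[OF \<psi>_measurable y])
  show "(\<lambda>u. \<psi> k y u *\<^sub>R g u) \<in> borel_measurable L" by measurable
  show "AE u in L. norm (\<psi> k y u *\<^sub>R g u) \<le> C / \<alpha>0 * B"
  proof (rule AE_I2)
    fix u assume "u \<in> space L"
    then show "norm (\<psi> k y u *\<^sub>R g u) \<le> C / \<alpha>0 * B"
      unfolding norm_scaleR
      using \<psi>_bounds[OF y, of u] B[of u] by (intro mult_mono) auto
  qed
qed

lemma integrable_\<psi>: "y \<in> space (P k) \<Longrightarrow> integrable L (\<psi> k y)"
  using integrable_\<psi>_mult[of y k "\<lambda>_. 1::real" 1] by simp

lemma integral_\<psi>: "y \<in> space (P k) \<Longrightarrow> (\<integral>u. \<psi> k y u \<partial>L) = 1"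
  unfolding \<psi>_eq using \<alpha>s_ge[of y k] \<alpha>0_pos by (simp add: \<alpha>s_def[symmetric])

lemma past_eq:
  "past M D X k = vimage_algebra (space M) (past_points k) (P k)"
proof -
  have "sets (\<Pi>\<^sub>M i\<in>{1..k}. restrict_space borel D) = sets (P k)"
    by (intro sets_PiM_cong) (auto simp: sets_L)
  moreover from this have "space (\<Pi>\<^sub>M i\<in>{1..k}. restrict_space borel D) = space (P k)"
    by (rule sets_eq_imp_space_eq)
  ultimately show ?thesis unfolding past_def vimage_algebra_def past_points_def by simp
qed

lemma subalgebra_past: "subalgebra M (past M D X k)"
proof -
  have "past_points k \<in> space M \<rightarrow> space (P k)" by (auto simp: past_points_space)
  then show ?thesis
    unfolding subalgebra_def past_eq
    using measurable_sets[OF past_points_measurable[of k]] by (auto simp: sets_vimage_algebra2)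
qed

text \<open>The event that the past lies in \<open>B\<close> belongs to \<open>past\<close>, so the
  conditional probability of the next point hitting \<open>A\<close> may be integrated over it and
  then replaced by the integral of the density. The conditional-probability clause of the process
  enters here.\<close>

lemma joint_rectangle:
  assumes B [measurable]: "B \<in> sets (P k)" and A [measurable]: "A \<in> sets L"
  shows "measure M {\<omega> \<in> space M. past_points k \<omega> \<in> B \<and> X (Suc k) \<omega> \<in> A} =
    (\<integral>\<omega>. indicator B (past_points k \<omega>) * (\<integral>u. indicator A u * \<psi> k (past_points k \<omega>) u \<partial>L) \<partial>M)"
proof -
  interpret F: finite_measure_subalgebra M "past M D X k"
    by unfold_locales (rule subalgebra_past)
  define S where "S = past_points k -` B \<inter> space M"
  have S: "S \<in> sets (past M D X k)"
    unfolding past_eq S_def by (rule in_vimage_algebra) fact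
  have [measurable]: "S \<in> sets M" using S subalgebra_past by (auto simp: subalgebra_def)
  define I where "I = (\<lambda>\<omega>. indicator A (X (Suc k) \<omega>) :: real)"
  have I: "integrable M I" unfolding I_def
    by (rule integrable_const_bound[of _ 1]) (auto simp: indicator_def)
  have "measure M {\<omega> \<in> space M. past_points k \<omega> \<in> B \<and> X (Suc k) \<omega> \<in> A}
      = (\<integral>\<omega>. indicator {\<omega> \<in> space M. past_points k \<omega> \<in> B \<and> X (Suc k) \<omega> \<in> A} \<omega> \<partial>M)"
    by simp
  also have "\<dots> = (LINT \<omega>:S|M. I \<omega>)"
    unfolding set_lebesgue_integral_def I_def S_def
    by (intro Bochner_Integration.integral_cong) (auto simp: indicator_def)
  also have "\<dots> = (LINT \<omega>:S|M. real_cond_exp M (past M D X k) I \<omega>)"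
    by (rule F.real_cond_exp_intA[OF I S])
  also have "\<dots> = (LINT \<omega>:S|M. (\<integral>u. indicator A u * \<psi> k (past_points k \<omega>) u \<partial>L))"
    unfolding set_lebesgue_integral_def
  proof (rule integral_cong_AE)
    have "AE \<omega> in M. real_cond_exp M (past M D X k) I \<omega> =
        (LINT x:A|lborel. next_density D R \<beta>s ((\<lambda>i. X i \<omega>) ` {1..k}) x)"
      using X_process A
      unfolding sequential_point_process_def I_def sets_L Suc_eq_plus1 by blast
    then show "AE \<omega> in M. indicator S \<omega> *\<^sub>R real_cond_exp M (past M D X k) I \<omega> =
        indicator S \<omega> *\<^sub>R (\<integral>u. indicator A u * \<psi> k (past_points k \<omega>) u \<partial>L)"
      by eventually_elim (simp add: set_integral_L[OF A] \<psi>_def image_past_points)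
    show "(\<lambda>\<omega>. indicator S \<omega> *\<^sub>R real_cond_exp M (past M D X k) I \<omega>) \<in> borel_measurable M"
      by measurable
    show "(\<lambda>\<omega>. indicator S \<omega> *\<^sub>R (\<integral>u. indicator A u * \<psi> k (past_points k \<omega>) u \<partial>L)) \<in> borel_measurable M"
      by measurable
  qed
  also have "\<dots> = (\<integral>\<omega>. indicator B (past_points k \<omega>) * (\<integral>u. indicator A u * \<psi> k (past_points k \<omega>) u \<partial>L) \<partial>M)"
    unfolding set_lebesgue_integral_def S_def
    by (intro Bochner_Integration.integral_cong) (auto simp: indicator_def)
  finally show ?thesis .
qed

text \<open>The process provides conditional probabilities with an exceptional null set for each
  \<open>A\<close> separately; a joint law is free of this dependence. Rectangles form an
  intersection-stable generator and both measures are finite on the whole space, so agreement on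
  rectangles suffices.\<close>

lemma joint_law:
  "distr M (P k \<Otimes>\<^sub>M L) (\<lambda>\<omega>. (past_points k \<omega>, X (Suc k) \<omega>)) =
   density (distr M (P k) (past_points k) \<Otimes>\<^sub>M L) (\<lambda>(y, u). ennreal (\<psi> k y u))"
  (is "?J = density ?Q _")
proof -
  let ?E = "{a \<times> c | a c. a \<in> sets (P k) \<and> c \<in> sets L}"
  interpret law: prob_space "distr M (P k) (past_points k)" by (rule prob_space_distr) simp
  interpret pair_sigma_finite "distr M (P k) (past_points k)" L ..
  have sets_Q [measurable_cong]: "sets ?Q = sets (P k \<Otimes>\<^sub>M L)"
    by (intro sets_pair_measure_cong) auto
  show ?thesis
  proof (rule measure_eqI_generator_eq[of ?E "space (P k) \<times> D" _ _ "\<lambda>_. space (P k) \<times> D"])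
    show "Int_stable ?E" by (rule Int_stable_pair_measure_generator)
    show "?E \<subseteq> Pow (space (P k) \<times> D)"
      using sets.sets_into_space[of _ "P k"] sets.sets_into_space[of _ L] by fastforce
    show "sets ?J = sigma_sets (space (P k) \<times> D) ?E"
      by (simp add: sets_pair_measure)
    show "sets (density ?Q (\<lambda>(y, u). ennreal (\<psi> k y u))) = sigma_sets (space (P k) \<times> D) ?E"
      by (simp add: sets_Q) (simp add: sets_pair_measure)
    show "range (\<lambda>_::nat. space (P k) \<times> D) \<subseteq> ?E" using sets.top[of L] sets.top[of "P k"] by auto
    show "(\<Union>i::nat. space (P k) \<times> D) = space (P k) \<times> D" by simp
    show "emeasure ?J (space (P k) \<times> D) \<noteq> \<infinity>"
      using finite_measure.emeasure_finite[OF finite_measure_distr,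
          of "\<lambda>\<omega>. (past_points k \<omega>, X (Suc k) \<omega>)" "P k \<Otimes>\<^sub>M L"] by simp
    fix Z assume "Z \<in> ?E"
    then obtain B A where Z: "Z = B \<times> A" and B [measurable]: "B \<in> sets (P k)" and A [measurable]: "A \<in> sets L"
      by auto
    have int: "integrable L (\<lambda>u. indicator A u * \<psi> k y u)" if "y \<in> space (P k)" for y
      using integrable_\<psi>_mult[OF that, of "indicator A :: _ \<Rightarrow> real" 1]
      by (simp add: mult.commute indicator_def)
    have nn: "(\<integral>u. indicator A u * \<psi> k y u \<partial>L) \<ge> 0" if "y \<in> space (P k)" for y
      using \<psi>_bounds(1)[OF that] by (intro integral_nonneg_AE AE_I2) (auto simp: less_imp_le)
    have le1: "(\<integral>u. indicator A u * \<psi> k y u \<partial>L) \<le> 1" if "y \<in> space (P k)" for y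
      using integral_mono[OF int[OF that] integrable_\<psi>[OF that]] \<psi>_bounds(1)[OF that]
      by (simp add: integral_\<psi>[OF that] indicator_def less_imp_le split: if_splits)
    have "emeasure (density ?Q (\<lambda>(y, u). ennreal (\<psi> k y u))) Z
        = (\<integral>\<^sup>+w. (case w of (y, u) \<Rightarrow> ennreal (\<psi> k y u)) * indicator Z w \<partial>?Q)"
      by (rule emeasure_density) (auto simp: Z)
    also have "\<dots> = (\<integral>\<^sup>+y. \<integral>\<^sup>+u. ennreal (\<psi> k y u) * indicator Z (y, u) \<partial>L \<partial>distr M (P k) (past_points k))"
      by (subst L.nn_integral_fst[symmetric]) (auto simp: Z)
    also have "\<dots> = (\<integral>\<^sup>+\<omega>. \<integral>\<^sup>+u. ennreal (\<psi> k (past_points k \<omega>) u) * indicator Z (past_points k \<omega>, u) \<partial>L \<partial>M)"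
      by (rule nn_integral_distr) (auto simp: Z)
    also have "\<dots> = (\<integral>\<^sup>+\<omega>. ennreal (indicator B (past_points k \<omega>) *
        (\<integral>u. indicator A u * \<psi> k (past_points k \<omega>) u \<partial>L)) \<partial>M)"
    proof (rule nn_integral_cong)
      fix \<omega> assume "\<omega> \<in> space M"
      then have y: "past_points k \<omega> \<in> space (P k)" (is "?y \<in> _") by (rule past_points_space)
      have "(\<integral>\<^sup>+u. ennreal (\<psi> k ?y u) * indicator Z (?y, u) \<partial>L)
          = (\<integral>\<^sup>+u. ennreal (indicator B ?y * (indicator A u * \<psi> k ?y u)) \<partial>L)"
        by (intro nn_integral_cong) (auto simp: Z indicator_def)
      also have "\<dots> = ennreal (\<integral>u. indicator B ?y * (indicator A u * \<psi> k ?y u) \<partial>L)"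
        using int[OF y] \<psi>_bounds(1)[OF y]
        by (intro nn_integral_eq_integral) (auto simp: less_imp_le)
      finally show "(\<integral>\<^sup>+u. ennreal (\<psi> k ?y u) * indicator Z (?y, u) \<partial>L)
          = ennreal (indicator B ?y * (\<integral>u. indicator A u * \<psi> k ?y u \<partial>L))"
        by simp
    qed
    also have "\<dots> = ennreal (\<integral>\<omega>. indicator B (past_points k \<omega>) *
        (\<integral>u. indicator A u * \<psi> k (past_points k \<omega>) u \<partial>L) \<partial>M)"
      using nn[OF past_points_space] le1[OF past_points_space]
      by (intro nn_integral_eq_integral integrable_const_bound[of _ 1] AE_I2)
        (auto simp: indicator_def)
    also have "\<dots> = emeasure ?J Z"
      by (subst emeasure_distr)
        (auto simp: Z joint_rectangle[OF B A, symmetric] emeasure_eq_measure vimage_def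
          intro!: arg_cong[where f = "measure M"])
    finally show "emeasure ?J Z = emeasure (density ?Q (\<lambda>(y, u). ennreal (\<psi> k y u))) Z" ..
  qed
qed

text \<open>The tower property, with the conditional expectation written out through the density.
  Values lie in a Banach space because both real means and complex characteristic functions are
  needed.\<close>

lemma integral_next:
  fixes G :: "(nat \<Rightarrow> 'a) \<Rightarrow> 'a \<Rightarrow> 'b::{banach,second_countable_topology}"
  assumes [measurable]: "case_prod G \<in> borel_measurable (P k \<Otimes>\<^sub>M L)"
    and B: "\<And>y u. y \<in> space (P k) \<Longrightarrow> u \<in> D \<Longrightarrow> norm (G y u) \<le> B"
  shows "(\<integral>\<omega>. G (past_points k \<omega>) (X (Suc k) \<omega>) \<partial>M)
    = (\<integral>\<omega>. (\<integral>u. \<psi> k (past_points k \<omega>) u *\<^sub>R G (past_points k \<omega>) u \<partial>L) \<partial>M)"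
proof -
  let ?law = "distr M (P k) (past_points k)"
  interpret law: prob_space ?law by (rule prob_space_distr) simp
  interpret pair_sigma_finite ?law L ..
  have sets_Q [measurable_cong]: "sets (?law \<Otimes>\<^sub>M L) = sets (P k \<Otimes>\<^sub>M L)"
    by (intro sets_pair_measure_cong) auto
  interpret Q: finite_measure "?law \<Otimes>\<^sub>M L"
    by (intro finite_measure_pair_measure) unfold_locales
  have "(\<integral>\<omega>. G (past_points k \<omega>) (X (Suc k) \<omega>) \<partial>M)
      = (\<integral>w. case_prod G w \<partial>distr M (P k \<Otimes>\<^sub>M L) (\<lambda>\<omega>. (past_points k \<omega>, X (Suc k) \<omega>)))"
    by (subst integral_distr) auto
  also have "\<dots> = (\<integral>w. case_prod (\<psi> k) w *\<^sub>R case_prod G w \<partial>(?law \<Otimes>\<^sub>M L))"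
    unfolding joint_law case_prod_beta
    using \<psi>_bounds(1)
    by (intro integral_density) (auto simp: space_pair_measure less_imp_le intro!: AE_I2)
  also have "\<dots> = (\<integral>y. (\<integral>u. \<psi> k y u *\<^sub>R G y u \<partial>L) \<partial>?law)"
  proof -
    have "integrable (?law \<Otimes>\<^sub>M L) (\<lambda>(y, u). \<psi> k y u *\<^sub>R G y u)"
    proof (intro Q.integrable_const_bound[of _ "C / \<alpha>0 * B"] AE_I2)
      fix w assume "w \<in> space (?law \<Otimes>\<^sub>M L)"
      then obtain y u where w: "w = (y, u)" "y \<in> space (P k)" "u \<in> D"
        by (auto simp: space_pair_measure)
      show "norm (case w of (y, u) \<Rightarrow> \<psi> k y u *\<^sub>R G y u) \<le> C / \<alpha>0 * B"
        unfolding w(1) prod.case norm_scaleR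
        using \<psi>_bounds[OF w(2,3)] B[OF w(2,3)] by (intro mult_mono) auto
    qed simp
    from integral_fst'[OF this] show ?thesis by (simp add: case_prod_unfold)
  qed
  also have "\<dots> = (\<integral>\<omega>. (\<integral>u. \<psi> k (past_points k \<omega>) u *\<^sub>R G (past_points k \<omega>) u \<partial>L) \<partial>M)"
    by (rule integral_distr) measurable
  finally show ?thesis .
qed

subsection \<open>Distance of the conditional density from its limit\<close>

text \<open>Finitely many cells of diameter at most \<open>r0\<close> cover D, and the cell of x
  lies in the interaction ball around x. Every cell of positive measure carries positive mass of
  \<open>lower\<close>, and a minimum over finitely many cells stays positive. Points in null cells
  have no such bound and form a null set.\<close>

lemma hitting_probability:
  obtains p where "p > 0" "AE x in L. \<forall>k. \<forall>y\<in>space (P k).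
    p \<le> (\<integral>u. indicator (cball x (R x)) u * \<psi> k y u \<partial>L)"
proof -
  obtain c where c: "finite c" "D \<subseteq> (\<Union>z\<in>c. ball z (r0 / 2))"
    using D_compact r0(1) unfolding compact_eq_totally_bounded by (meson half_gt_zero)
  define cell where "cell = (\<lambda>z. ball z (r0 / 2) \<inter> D)"
  have cell [measurable]: "cell z \<in> sets L" for z
    unfolding cell_def sets_L by (auto simp: sets_restrict_space)
  define I where "I = (\<lambda>z. \<integral>u. indicator (cell z) u * lower u \<partial>L)"
  define good where "good = {z \<in> c. emeasure L (cell z) > 0}"
  \<comment> \<open>The element 1 makes the minimum one of a nonempty set without having to know
    that a good cell exists.\<close>
  define m where "m = Min (insert 1 (I ` good))"
  have "m > 0"
    using c(1) set_integral_lower_pos[OF cell] by (auto simp: m_def good_def I_def)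
  have mass: "C * measure L D > 0" using C_pos D_pos by (simp add: L_mass)
  show ?thesis
  proof
    show "m / (C * measure L D) > 0" using \<open>m > 0\<close> mass by simp
    have "(\<Union>z\<in>c - good. cell z) \<in> null_sets L"
      using c(1) by (intro null_sets_UN' countable_finite)
        (auto simp: good_def null_sets_def zero_less_iff_neq_zero)
    then have "AE x in L. x \<notin> (\<Union>z\<in>c - good. cell z)" by (rule AE_not_in)
    then show "AE x in L. \<forall>k. \<forall>y\<in>space (P k).
        m / (C * measure L D) \<le> (\<integral>u. indicator (cball x (R x)) u * \<psi> k y u \<partial>L)"
      using AE_space
    proof (eventually_elim, intro allI ballI)
      fix x k y assume x: "x \<notin> (\<Union>z\<in>c - good. cell z)" "x \<in> space L" and y: "y \<in> space (P k)"
      then obtain z where "z \<in> c" "x \<in> cell z" using c(2) by (auto simp: cell_def)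
      with x have z: "z \<in> good" "x \<in> cell z" by auto
      have [measurable]: "\<psi> k y \<in> borel_measurable L"
        by (rule measurable_section[OF \<psi>_measurable y])
      have "cell z \<subseteq> cball x (R x)"
      proof
        fix u assume "u \<in> cell z"
        then have "dist x u < r0"
          using z(2) dist_triangle_half_l[of x z r0 u] by (simp add: cell_def dist_commute)
        then show "u \<in> cball x (R x)" using r0(2)[of x] x(2) by auto
      qed
      \<comment> \<open>The numerator is at least \<open>lower u\<close> and the normalizer at most
        \<open>C * measure L D\<close>; this is the source of the constant p.\<close>
      have lower_\<psi>: "lower u / (C * measure L D) \<le> \<psi> k y u" if "u \<in> D" for u
        unfolding \<psi>_eq
        using lower_le[OF that] lower_pos[OF that] \<alpha>s_le[OF y] \<alpha>s_ge[OF y] \<alpha>0_pos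
        by (intro frac_le) (auto intro: less_imp_le order_trans)
      have "m \<le> I z" unfolding m_def using z(1) c(1) by (intro Min_le) (auto simp: good_def)
      then have "m / (C * measure L D) \<le> I z / (C * measure L D)"
        using mass by (intro divide_right_mono) auto
      also have "\<dots> = (\<integral>u. indicator (cell z) u * (lower u / (C * measure L D)) \<partial>L)"
        unfolding I_def by simp
      also have "\<dots> \<le> (\<integral>u. indicator (cball x (R x)) u * \<psi> k y u \<partial>L)"
      proof (rule integral_mono)
        have int: "integrable L (\<lambda>u. f u * indicator A u)"
          if "integrable L f" "A \<inter> D \<in> sets L" for f :: "'a \<Rightarrow> real" and A
        proof -
          have "integrable L (\<lambda>u. f u * indicator (A \<inter> D) u)"
            using that by (intro integrable_real_mult_indicator)
          then show ?thesis
            by (rule Bochner_Integration.integrable_cong[OF refl, THEN iffD1, rotated])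
              (auto simp: indicator_def)
        qed
        have cb: "cball x (R x) \<inter> D \<in> sets L" by (auto simp: sets_L sets_restrict_space)
        show "integrable L (\<lambda>u. indicator (cell z) u * (lower u / (C * measure L D)))"
          using int[of "\<lambda>u. lower u / (C * measure L D)" "cell z"] integrable_lower
          by (simp add: mult.commute cell_def)
            (use cell[of z] in \<open>simp add: cell_def Int_assoc\<close>)
        show "integrable L (\<lambda>u. indicator (cball x (R x)) u * \<psi> k y u)"
          using int[OF integrable_\<psi>[OF y] cb] by (simp add: mult.commute)
        show "indicator (cell z) u * (lower u / (C * measure L D)) \<le> indicator (cball x (R x)) u * \<psi> k y u"
          if "u \<in> space L" for u
          using that lower_\<psi>[of u] \<psi>_bounds(1)[OF y, of u] \<open>cell z \<subseteq> cball x (R x)\<close>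
          by (auto simp: indicator_def less_imp_le)
      qed
      finally show "m / (C * measure L D) \<le> (\<integral>u. indicator (cball x (R x)) u * \<psi> k y u \<partial>L)" .
    qed
  qed
qed

lemma count_le: "count k y u \<le> k"
  by (simp add: count_def neighbour_count_image_le)

lemma count_past_points_Suc:
  "count (Suc k) (past_points (Suc k) \<omega>) x = count k (past_points k \<omega>) x +
    of_bool (dist x (X (Suc k) \<omega>) \<le> R x \<and> X (Suc k) \<omega> \<notin> past_points k \<omega> ` {1..k})"
  unfolding count_def image_past_points by (rule neighbour_count_image_Suc)

text \<open>The process \<open>\<Sum>j<count. \<phi> j\<close> grows by \<open>\<phi> count\<close> at each visit to the ball around \<open>x\<close>, and such a
  visit has conditional probability at least \<open>p\<close>.\<close>

lemma occupation_bound: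
  fixes \<phi> :: "nat \<Rightarrow> real"
  assumes \<phi>: "\<And>n. \<phi> n \<ge> 0" and x: "x \<in> D"
    and p: "\<And>k y. y \<in> space (P k) \<Longrightarrow> p \<le> (\<integral>u. indicator (cball x (R x)) u * \<psi> k y u \<partial>L)"
  shows "p * (\<Sum>k<m. \<integral>\<omega>. \<phi> (count k (past_points k \<omega>) x) \<partial>M) \<le> (\<Sum>j<m. \<phi> j)"
proof -
  define \<Phi> where "\<Phi> = (\<lambda>n. \<Sum>j<n. \<phi> j)"
  have \<Phi>_mono: "\<Phi> n \<le> \<Phi> k" if "n \<le> k" for n k
    unfolding \<Phi>_def using \<phi> that by (intro sum_mono2) auto
  have \<Phi>_nonneg: "\<Phi> n \<ge> 0" for n unfolding \<Phi>_def using \<phi> by (intro sum_nonneg) auto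
  have \<phi>_le: "\<phi> n \<le> \<Phi> (Suc k)" if "n \<le> k" for n k
    using \<Phi>_mono[of "Suc n" "Suc k"] \<Phi>_nonneg[of n] that by (simp add: \<Phi>_def)
  define N where "N = (\<lambda>k \<omega>. count k (past_points k \<omega>) x)"
  have count_x [measurable]: "(\<lambda>y. count k y x) \<in> P k \<rightarrow>\<^sub>M count_space UNIV" for k
    using measurable_compose[OF measurable_Pair2'[of x L "P k"] count_measurable] x by simp
  have N [measurable]: "N k \<in> M \<rightarrow>\<^sub>M count_space UNIV" for k unfolding N_def by measurable
  have int: "integrable M (\<lambda>\<omega>. \<Phi> (N k \<omega>)) \<and> integrable M (\<lambda>\<omega>. \<phi> (N k \<omega>))" for k
    using \<Phi>_mono[OF count_le] \<Phi>_nonneg \<phi> \<phi>_le[OF count_le]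
    by (intro conjI integrable_const_bound[of _ "\<Phi> k"] integrable_const_bound[of _ "\<Phi> (Suc k)"])
      (simp_all add: N_def)
  have step: "p * (\<integral>\<omega>. \<phi> (N k \<omega>) \<partial>M) \<le> (\<integral>\<omega>. \<Phi> (N (Suc k) \<omega>) \<partial>M) - (\<integral>\<omega>. \<Phi> (N k \<omega>) \<partial>M)" for k
  proof -
    \<comment> \<open>\<open>G\<close> is the increment of \<Phi> along the count, as a function of
      the past and of the new point: it is \<phi> of the old count if the new point falls into the
      ball and is not a repetition, and 0 otherwise.\<close>
    define G where "G = (\<lambda>y u. \<phi> (count k y x) * of_bool (dist x u \<le> R x \<and> (\<forall>i\<in>{1..k}. u \<noteq> y i)))"
    have G_meas [measurable]: "case_prod G \<in> borel_measurable (P k \<Otimes>\<^sub>M L)"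
    proof -
      have "Measurable.pred (P k \<Otimes>\<^sub>M L) (\<lambda>w. \<forall>i\<in>{1..k}. snd w \<noteq> fst w i)"
      proof (rule pred_intros_finite(3))
        fix i assume "i \<in> {1..k}"
        then have "(\<lambda>w. fst w i) \<in> P k \<Otimes>\<^sub>M L \<rightarrow>\<^sub>M L" by measurable
        then have [measurable]: "(\<lambda>w. fst w i) \<in> P k \<Otimes>\<^sub>M L \<rightarrow>\<^sub>M borel"
          by (rule measurable_compose[OF _ ident_measurable])
        show "Measurable.pred (P k \<Otimes>\<^sub>M L) (\<lambda>w. snd w \<noteq> fst w i)"
          by measurable
      qed simp
      then show ?thesis unfolding G_def of_bool_def case_prod_unfold by measurable
    qed
    have G_bound: "norm (G y u) \<le> \<Phi> (Suc k)" for y u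
      using \<phi> \<phi>_le[OF count_le[of k y x]] \<Phi>_nonneg[of "Suc k"] by (auto simp: G_def)
    have G_int: "(\<integral>u. \<psi> k y u *\<^sub>R G y u \<partial>L) \<ge> p * \<phi> (count k y x)" if y: "y \<in> space (P k)" for y
    proof -
      have [measurable]: "\<psi> k y \<in> borel_measurable L"
        by (rule measurable_section[OF \<psi>_measurable y])
      have [measurable]: "G y \<in> borel_measurable L"
        by (rule measurable_section[OF G_meas y])
      \<comment> \<open>Repetitions of earlier points have Lebesgue measure 0, so the lower bound p
        for the whole ball still applies to genuinely new points.\<close>
      have "finite (y ` {1..k})" by simp
      then have "y ` {1..k} \<in> null_sets lborel" by (rule finite_imp_null_set_lborel)
      then have "AE u in lborel. u \<notin> y ` {1..k}" by (rule AE_not_in)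
      then have "AE u in L. u \<notin> y ` {1..k}"
        unfolding L_def by (subst AE_restrict_space_iff) auto
      then have "(\<integral>u. \<psi> k y u *\<^sub>R G y u \<partial>L) =
          (\<integral>u. \<phi> (count k y x) * (indicator (cball x (R x)) u * \<psi> k y u) \<partial>L)"
        by (intro integral_cong_AE) (auto simp: G_def indicator_def elim!: eventually_mono)
      also have "\<dots> = \<phi> (count k y x) * (\<integral>u. indicator (cball x (R x)) u * \<psi> k y u \<partial>L)" by simp
      also have "\<dots> \<ge> \<phi> (count k y x) * p" using p[OF y] \<phi> by (intro mult_left_mono) auto
      finally show ?thesis by (simp add: mult.commute)
    qed
    have "(\<integral>\<omega>. \<Phi> (N (Suc k) \<omega>) \<partial>M) - (\<integral>\<omega>. \<Phi> (N k \<omega>) \<partial>M) = (\<integral>\<omega>. \<Phi> (N (Suc k) \<omega>) - \<Phi> (N k \<omega>) \<partial>M)"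
      using int by simp
    also have "\<dots> = (\<integral>\<omega>. G (past_points k \<omega>) (X (Suc k) \<omega>) \<partial>M)"
      unfolding N_def count_past_points_Suc G_def
      by (intro Bochner_Integration.integral_cong refl) (auto simp: \<Phi>_def image_iff Suc_eq_plus1[symmetric])
    also have "\<dots> = (\<integral>\<omega>. (\<integral>u. \<psi> k (past_points k \<omega>) u *\<^sub>R G (past_points k \<omega>) u \<partial>L) \<partial>M)"
      by (rule integral_next[OF G_meas G_bound])
    also have "\<dots> \<ge> (\<integral>\<omega>. p * \<phi> (N k \<omega>) \<partial>M)"
    proof (rule integral_mono)
      show "integrable M (\<lambda>\<omega>. p * \<phi> (N k \<omega>))" using int by simp
      show "integrable M (\<lambda>\<omega>. \<integral>u. \<psi> k (past_points k \<omega>) u *\<^sub>R G (past_points k \<omega>) u \<partial>L)"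
      proof (rule integrable_const_bound[of _ "\<Phi> (Suc k)"])
        show "AE \<omega> in M. norm (\<integral>u. \<psi> k (past_points k \<omega>) u *\<^sub>R G (past_points k \<omega>) u \<partial>L) \<le> \<Phi> (Suc k)"
        proof (rule AE_I2)
          fix \<omega> assume "\<omega> \<in> space M"
          then have y: "past_points k \<omega> \<in> space (P k)" (is "?y \<in> _") by (rule past_points_space)
          have "norm (\<integral>u. \<psi> k ?y u *\<^sub>R G ?y u \<partial>L) \<le> (\<integral>u. norm (\<psi> k ?y u *\<^sub>R G ?y u) \<partial>L)"
            by (rule integral_norm_bound)
          also have "\<dots> \<le> (\<integral>u. \<Phi> (Suc k) * \<psi> k ?y u \<partial>L)"
            using integrable_norm[OF integrable_\<psi>_mult[OF y measurable_section[OF G_meas y] G_bound]]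
              integrable_\<psi>[OF y] G_bound[of ?y] \<psi>_bounds(1)[OF y]
            by (intro integral_mono) (simp_all add: mult.commute[of "\<Phi> (Suc k)"] mult_left_mono less_imp_le abs_mult)
          also have "\<dots> = \<Phi> (Suc k)" by (simp add: integral_\<psi>[OF y])
          finally show "norm (\<integral>u. \<psi> k ?y u *\<^sub>R G ?y u \<partial>L) \<le> \<Phi> (Suc k)" .
        qed
      qed measurable
      show "p * \<phi> (N k \<omega>) \<le> (\<integral>u. \<psi> k (past_points k \<omega>) u *\<^sub>R G (past_points k \<omega>) u \<partial>L)"
        if "\<omega> \<in> space M" for \<omega>
        unfolding N_def by (rule G_int[OF past_points_space[OF that]])
    qed
    finally show ?thesis by simp
  qed
  have "p * (\<Sum>k<m. \<integral>\<omega>. \<phi> (N k \<omega>) \<partial>M) \<le> (\<Sum>k<m. (\<integral>\<omega>. \<Phi> (N (Suc k) \<omega>) \<partial>M) - (\<integral>\<omega>. \<Phi> (N k \<omega>) \<partial>M))"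
    unfolding sum_distrib_left by (intro sum_mono step)
  also have "\<dots> = (\<integral>\<omega>. \<Phi> (N m \<omega>) \<partial>M) - (\<integral>\<omega>. \<Phi> (N 0 \<omega>) \<partial>M)" by (rule sum_lessThan_telescope)
  also have "\<dots> \<le> (\<integral>\<omega>. \<Phi> m \<partial>M)"
  proof -
    have "(\<integral>\<omega>. \<Phi> (N m \<omega>) \<partial>M) \<le> (\<integral>\<omega>. \<Phi> m \<partial>M)"
      using \<Phi>_mono[OF count_le] int by (intro integral_mono) (auto simp: N_def)
    moreover have "(\<integral>\<omega>. \<Phi> (N 0 \<omega>) \<partial>M) \<ge> 0" using \<Phi>_nonneg by (intro integral_nonneg_AE) auto
    ultimately show ?thesis by simp
  qed
  finally show ?thesis by (simp add: N_def \<Phi>_def prob_space)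
qed

section \<open>The limit density and the distance of the conditional densities from it\<close>

definition \<alpha> :: real where "\<alpha> = (\<integral>u. \<beta> u \<partial>L)"

definition \<rho> :: "'a \<Rightarrow> real" where "\<rho> u = \<beta> u / \<alpha>"

lemma \<rho>_measurable [measurable]: "\<rho> \<in> borel_measurable L"
  unfolding \<rho>_def by measurable

lemma integrable_\<beta>: "integrable L \<beta>"
proof (rule L.integrable_const_bound[of _ C])
  show "AE x in L. norm (\<beta> x) \<le> C"
  proof (rule AE_I2)
    fix x assume "x \<in> space L"
    then show "norm (\<beta> x) \<le> C" using b(1) b(2)[of x] \<beta>_le[of x] by simp
  qed
qed simp

lemma \<alpha>_pos: "\<alpha> > 0"
proof -
  have "0 < b * measure L D" using b D_pos by (simp add: L_mass)
  also have "\<dots> = (\<integral>u. b \<partial>L)" by simp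
  also have "\<dots> \<le> \<alpha>" unfolding \<alpha>_def using b by (intro integral_mono integrable_\<beta>) auto
  finally show ?thesis .
qed

lemma \<rho>_pos: "u \<in> D \<Longrightarrow> \<rho> u > 0"
  using b(1) b(2)[of u] \<alpha>_pos by (simp add: \<rho>_def)

lemma integrable_\<rho>: "integrable L \<rho>"
  unfolding \<rho>_def using integrable_\<beta> by simp

lemma integral_\<rho>: "(\<integral>u. \<rho> u \<partial>L) = 1"
  unfolding \<rho>_def using \<alpha>_pos by (simp add: \<alpha>_def[symmetric])

text \<open>The full distance in the integral norm, without the factor 1 / 2 of total variation; its
  maximal value is therefore 2.\<close>

definition tv :: "nat \<Rightarrow> (nat \<Rightarrow> 'a) \<Rightarrow> real" where
  "tv k y = (\<integral>u. \<bar>\<psi> k y u - \<rho> u\<bar> \<partial>L)"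

lemma tv_measurable [measurable]: "tv k \<in> borel_measurable (P k)"
  unfolding tv_def by (rule L.borel_measurable_lebesgue_integral) measurable

lemma tv_nonneg: "tv k y \<ge> 0"
  unfolding tv_def by simp

lemma tv_le_2:
  assumes y: "y \<in> space (P k)"
  shows "tv k y \<le> 2"
proof -
  have "tv k y \<le> (\<integral>u. \<psi> k y u + \<rho> u \<partial>L)"
    unfolding tv_def
  proof (rule integral_mono)
    fix u assume "u \<in> space L"
    then show "\<bar>\<psi> k y u - \<rho> u\<bar> \<le> \<psi> k y u + \<rho> u"
      using \<psi>_bounds(1)[OF y, of u] \<rho>_pos[of u] by simp
  qed (use integrable_\<psi>[OF y] integrable_\<rho> in auto)
  then show ?thesis using integrable_\<psi>[OF y] integrable_\<rho> by (simp add: integral_\<psi>[OF y] integral_\<rho>)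
qed

lemma integrable_tv: "integrable M (\<lambda>\<omega>. tv k (past_points k \<omega>))"
  using tv_nonneg tv_le_2[OF past_points_space]
  by (intro integrable_const_bound[of _ 2]) auto

text \<open>The difference of the two quotients splits into a change of numerator and a change of
  normalizer. The normalizers differ by at most the integral of the difference of the numerators, so
  both parts obey the same bound; this gives the factor 2.\<close>

lemma tv_le:
  assumes y: "y \<in> space (P k)"
  shows "tv k y \<le> 2 / \<alpha>0 * (\<integral>u. \<bar>\<beta>s (count k y u) u - \<beta> u\<bar> \<partial>L)"
proof -
  define I where "I = (\<integral>u. \<bar>\<beta>s (count k y u) u - \<beta> u\<bar> \<partial>L)"
  define a where "a = \<alpha>s k y"
  have a: "a > 0" "\<alpha>0 \<le> a" using \<alpha>s_ge[OF y] \<alpha>0_pos by (auto simp: a_def)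
  note int = integrable_\<beta>s_count[OF y] integrable_\<beta>
  have I: "I \<ge> 0" unfolding I_def by simp
  have "\<bar>a - \<alpha>\<bar> = \<bar>\<integral>u. \<beta>s (count k y u) u - \<beta> u \<partial>L\<bar>"
    using int by (simp add: a_def \<alpha>s_def \<alpha>_def)
  also have "\<dots> \<le> I" unfolding I_def by (rule integral_abs_bound)
  finally have diff: "\<bar>a - \<alpha>\<bar> \<le> I" .
  have "tv k y \<le> (\<integral>u. \<bar>\<beta>s (count k y u) u - \<beta> u\<bar> / a + \<beta> u * (\<bar>a - \<alpha>\<bar> / (a * \<alpha>)) \<partial>L)"
    unfolding tv_def
  proof (rule integral_mono)
    show "integrable L (\<lambda>u. \<bar>\<psi> k y u - \<rho> u\<bar>)" using integrable_\<psi>[OF y] integrable_\<rho> by auto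
    show "integrable L (\<lambda>u. \<bar>\<beta>s (count k y u) u - \<beta> u\<bar> / a + \<beta> u * (\<bar>a - \<alpha>\<bar> / (a * \<alpha>)))"
      using int by auto
    fix u assume "u \<in> space L"
    then have \<beta>0: "\<beta> u > 0" using b(1) b(2)[of u] by simp
    have "\<psi> k y u - \<rho> u = (\<beta>s (count k y u) u - \<beta> u) / a + \<beta> u * ((\<alpha> - a) / (a * \<alpha>))"
      using a \<alpha>_pos by (simp add: \<psi>_eq \<rho>_def a_def[symmetric] field_simps)
    also have "\<bar>\<dots>\<bar> \<le> \<bar>(\<beta>s (count k y u) u - \<beta> u) / a\<bar> + \<bar>\<beta> u * ((\<alpha> - a) / (a * \<alpha>))\<bar>"
      by (rule abs_triangle_ineq)
    also have "\<dots> = \<bar>\<beta>s (count k y u) u - \<beta> u\<bar> / a + \<beta> u * (\<bar>a - \<alpha>\<bar> / (a * \<alpha>))"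
      using a \<alpha>_pos \<beta>0 by (simp add: abs_mult abs_minus_commute)
    finally show "\<bar>\<psi> k y u - \<rho> u\<bar> \<le> \<dots>" .
  qed
  also have "\<dots> = I / a + \<alpha> * (\<bar>a - \<alpha>\<bar> / (a * \<alpha>))"
    using int by (simp add: I_def \<alpha>_def)
  also have "\<dots> = (I + \<bar>a - \<alpha>\<bar>) / a" using \<alpha>_pos a by (simp add: field_simps)
  also have "\<dots> \<le> (2 * I) / a" using diff a by (intro divide_right_mono) auto
  also have "\<dots> \<le> (2 * I) / \<alpha>0" using a \<alpha>0_pos I by (intro divide_left_mono) auto
  finally show ?thesis by (simp add: I_def)
qed

text \<open>The expected distance at step k. It bounds both the bias of a mean and the cost of
  replacing one point by an independent point of density \<rho>.\<close>

definition drift :: "nat \<Rightarrow> real" where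
  "drift k = (\<integral>\<omega>. tv k (past_points k \<omega>) \<partial>M)"

lemma drift_nonneg: "drift k \<ge> 0"
  unfolding drift_def using tv_nonneg by (intro integral_nonneg_AE) auto

text \<open>Fubini exchanges expectation and integration over D, so the occupation bound can be used
  at almost every fixed point. The constant collects the factor \<open>2 / \<alpha>0\<close> from
  the distance estimate, the bound \<open>T\<close> from the rate, and
  \<open>measure L D / p\<close> from the occupation times.\<close>

lemma drift_sum_le:
  fixes \<phi> :: "nat \<Rightarrow> real"
  assumes \<phi>: "\<And>n. \<phi> n \<ge> 0" and rate: "\<And>n x. x \<in> D \<Longrightarrow> \<bar>\<beta>s n x - \<beta> x\<bar> \<le> T * \<phi> n" and T: "T \<ge> 0"
  obtains K where "\<And>m. (\<Sum>k<m. drift k) \<le> K * (\<Sum>j<m. \<phi> j)"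
proof -
  obtain p where p: "p > 0" "AE x in L. \<forall>k. \<forall>y\<in>space (P k).
    p \<le> (\<integral>u. indicator (cball x (R x)) u * \<psi> k y u \<partial>L)"
    by (rule hitting_probability)
  interpret pair_sigma_finite M L ..
  interpret product: finite_measure "M \<Otimes>\<^sub>M L" by (intro finite_measure_pair_measure) unfold_locales
  define h where "h = (\<lambda>k \<omega> u. \<phi> (count k (past_points k \<omega>) u))"
  have h [measurable]: "case_prod (h k) \<in> borel_measurable (M \<Otimes>\<^sub>M L)" for k
    unfolding h_def by measurable
  have h_le: "\<bar>h k \<omega> u\<bar> \<le> (\<Sum>j\<le>k. \<phi> j)" for k \<omega> u
    unfolding h_def using \<phi> count_le[of k "past_points k \<omega>" u] by (auto intro!: member_le_sum)
  have h_int: "integrable (M \<Otimes>\<^sub>M L) (case_prod (h k))" for k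
    using h_le by (intro product.integrable_const_bound[of _ "\<Sum>j\<le>k. \<phi> j"]) auto
  have hL: "integrable L (h k \<omega>)" if "\<omega> \<in> space M" for k \<omega>
    using h_le measurable_compose[OF measurable_Pair1'[OF that, of L] h[of k]]
    by (intro L.integrable_const_bound[of _ "\<Sum>j\<le>k. \<phi> j"]) auto
  have drift_le: "drift k \<le> 2 / \<alpha>0 * T * (\<integral>u. (\<integral>\<omega>. h k \<omega> u \<partial>M) \<partial>L)" for k
  proof -
    have "drift k \<le> (\<integral>\<omega>. 2 / \<alpha>0 * T * (\<integral>u. h k \<omega> u \<partial>L) \<partial>M)"
      unfolding drift_def
    proof (rule integral_mono[OF integrable_tv])
      show "integrable M (\<lambda>\<omega>. 2 / \<alpha>0 * T * (\<integral>u. h k \<omega> u \<partial>L))"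
        using integrable_fst'[OF h_int[of k]] by simp
      fix \<omega> assume \<omega>: "\<omega> \<in> space M"
      then have y: "past_points k \<omega> \<in> space (P k)" (is "?y \<in> _") by (rule past_points_space)
      have "(\<integral>u. \<bar>\<beta>s (count k ?y u) u - \<beta> u\<bar> \<partial>L) \<le> (\<integral>u. T * h k \<omega> u \<partial>L)"
        using rate integrable_\<beta>s_count[OF y] integrable_\<beta> hL[OF \<omega>]
        by (intro integral_mono) (auto simp: h_def)
      then have "2 / \<alpha>0 * (\<integral>u. \<bar>\<beta>s (count k ?y u) u - \<beta> u\<bar> \<partial>L) \<le> 2 / \<alpha>0 * (T * (\<integral>u. h k \<omega> u \<partial>L))"
        using \<alpha>0_pos by (intro mult_left_mono) auto
      then show "tv k ?y \<le> 2 / \<alpha>0 * T * (\<integral>u. h k \<omega> u \<partial>L)"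
        using tv_le[OF y] by (simp add: mult.assoc)
    qed
    also have "\<dots> = 2 / \<alpha>0 * T * (\<integral>\<omega>. (\<integral>u. h k \<omega> u \<partial>L) \<partial>M)" by simp
    also have "(\<integral>\<omega>. (\<integral>u. h k \<omega> u \<partial>L) \<partial>M) = (\<integral>u. (\<integral>\<omega>. h k \<omega> u \<partial>M) \<partial>L)"
      by (rule Fubini_integral[symmetric]) (rule h_int)
    finally show ?thesis .
  qed
  define K where "K = 2 / \<alpha>0 * T * (measure L D / p)"
  show ?thesis
  proof
    fix m
    have "(\<Sum>k<m. drift k) \<le> (\<Sum>k<m. 2 / \<alpha>0 * T * (\<integral>u. (\<integral>\<omega>. h k \<omega> u \<partial>M) \<partial>L))"
      by (intro sum_mono drift_le)
    also have "\<dots> = 2 / \<alpha>0 * T * (\<integral>u. (\<Sum>k<m. (\<integral>\<omega>. h k \<omega> u \<partial>M)) \<partial>L)"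
      using integrable_snd[OF h_int] by (simp add: sum_distrib_left)
    also have "\<dots> \<le> 2 / \<alpha>0 * T * (\<integral>u. (\<Sum>j<m. \<phi> j) / p \<partial>L)"
    proof (intro mult_left_mono integral_mono_AE)
      show "integrable L (\<lambda>u. \<Sum>k<m. \<integral>\<omega>. h k \<omega> u \<partial>M)"
        using integrable_snd[OF h_int] by simp
      show "AE u in L. (\<Sum>k<m. \<integral>\<omega>. h k \<omega> u \<partial>M) \<le> (\<Sum>j<m. \<phi> j) / p"
        using p(2) AE_space
      proof eventually_elim
        case (elim x)
        then show ?case
          using occupation_bound[OF \<phi>, where x = x and p = p and m = m] p(1) by (simp add: h_def field_simps)
      qed
    qed (use \<alpha>0_pos T in auto)
    also have "\<dots> = K * (\<Sum>j<m. \<phi> j)" by (simp add: K_def)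
    finally show "(\<Sum>k<m. drift k) \<le> K * (\<Sum>j<m. \<phi> j)" .
  qed
qed

end

subsection \<open>Characteristic functions of the partial sums\<close>

lemma norm_iexp_minus_1_le: "norm (iexp x - 1) \<le> \<bar>x\<bar>"
  using iexp_approx1[of x 0] by simp

lemma norm_iexp_minus_quadratic_le:
  "norm (iexp x - (1 + \<i> * complex_of_real x - complex_of_real (x\<^sup>2) / 2)) \<le> \<bar>x\<bar> ^ 3 / 6"
proof -
  have "(\<Sum>k\<le>2. (\<i> * complex_of_real x) ^ k / fact k)
      = 1 + \<i> * complex_of_real x - complex_of_real (x\<^sup>2) / 2"
    by (simp add: atMost_nat_numeral power_mult_distrib)
  then show ?thesis using iexp_approx1[of x 2] by (simp add: fact_numeral)
qed

context local_interaction
begin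

lemma integrable_\<rho>_scaleR:
  fixes h :: "'a \<Rightarrow> 'b::{banach,second_countable_topology}"
  assumes [measurable]: "h \<in> borel_measurable L" and h: "\<And>u. u \<in> D \<Longrightarrow> norm (h u) \<le> A"
  shows "integrable L (\<lambda>u. \<rho> u *\<^sub>R h u)"
proof (rule Bochner_Integration.integrable_bound[of _ "\<lambda>u. A * \<rho> u"])
  show "AE u in L. norm (\<rho> u *\<^sub>R h u) \<le> norm (A * \<rho> u)"
  proof (rule AE_I2)
    fix u assume "u \<in> space L"
    then show "norm (\<rho> u *\<^sub>R h u) \<le> norm (A * \<rho> u)"
      using h[of u] \<rho>_pos[of u] norm_ge_zero[of "h u"]
      by (simp add: abs_mult mult.commute[of A] mult_left_mono)
  qed
qed (use integrable_\<rho> in auto)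

text \<open>Since \<psi> and \<rho> both have integral 1, subtracting a constant c from
  \<open>e\<close> does not change the difference of the two integrals. The cost is therefore
  governed by the distance \<open>B'\<close> of \<open>e\<close> from c and not by the size of
  \<open>e\<close>. For the character of a small summand the choice c = 1 makes \<open>B'\<close>
  small.\<close>

lemma next_step_error:
  fixes Z :: "(nat \<Rightarrow> 'a) \<Rightarrow> 'b::{banach,second_countable_topology,real_normed_algebra}" and e :: "'a \<Rightarrow> 'b"
  assumes [measurable]: "Z \<in> borel_measurable (P k)" "e \<in> borel_measurable L"
    and Z: "\<And>y. y \<in> space (P k) \<Longrightarrow> norm (Z y) \<le> 1" and e: "\<And>u. u \<in> D \<Longrightarrow> norm (e u) \<le> B"
    and e_c: "\<And>u. u \<in> D \<Longrightarrow> norm (e u - c) \<le> B'"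
  shows "norm ((\<integral>\<omega>. Z (past_points k \<omega>) * e (X (Suc k) \<omega>) \<partial>M)
    - (\<integral>\<omega>. Z (past_points k \<omega>) \<partial>M) * (\<integral>u. \<rho> u *\<^sub>R e u \<partial>L)) \<le> B' * drift k"
proof -
  obtain u0 where "u0 \<in> D" using D_pos by fastforce
  then have B0: "B \<ge> 0" "B' \<ge> 0" using e[of u0] e_c[of u0] norm_ge_zero by (blast intro: order_trans)+
  have Zint: "integrable M (\<lambda>\<omega>. Z (past_points k \<omega>))"
    using Z[OF past_points_space] by (intro integrable_const_bound[of _ 1]) auto
  define r where "r = (\<lambda>y. \<integral>u. (\<psi> k y u - \<rho> u) *\<^sub>R (e u - c) \<partial>L)"
  have r_meas [measurable]: "r \<in> borel_measurable (P k)"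
    unfolding r_def by (rule L.borel_measurable_lebesgue_integral) measurable
  have r_eq: "r y = (\<integral>u. \<psi> k y u *\<^sub>R e u \<partial>L) - (\<integral>u. \<rho> u *\<^sub>R e u \<partial>L)" if y: "y \<in> space (P k)" for y
  proof -
    have i: "integrable L (\<lambda>u. \<psi> k y u *\<^sub>R e u)" "integrable L (\<lambda>u. \<rho> u *\<^sub>R e u)"
      "integrable L (\<lambda>u. \<psi> k y u *\<^sub>R c)" "integrable L (\<lambda>u. \<rho> u *\<^sub>R c)"
      using integrable_\<psi>_mult[OF y _ e] integrable_\<rho>_scaleR[OF _ e] integrable_\<psi>[OF y] integrable_\<rho> by auto
    have "r y = (\<integral>u. (\<psi> k y u *\<^sub>R e u - \<rho> u *\<^sub>R e u) - (\<psi> k y u *\<^sub>R c - \<rho> u *\<^sub>R c) \<partial>L)"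
      unfolding r_def by (intro Bochner_Integration.integral_cong) (auto simp: algebra_simps)
    also have "\<dots> = (\<integral>u. \<psi> k y u *\<^sub>R e u \<partial>L) - (\<integral>u. \<rho> u *\<^sub>R e u \<partial>L)
        - ((\<integral>u. \<psi> k y u *\<^sub>R c \<partial>L) - (\<integral>u. \<rho> u *\<^sub>R c \<partial>L))"
      using i by simp
    also have "(\<integral>u. \<psi> k y u *\<^sub>R c \<partial>L) = c"
      using integral_\<psi>[OF y] integrable_\<psi>[OF y] by simp
    also have "(\<integral>u. \<rho> u *\<^sub>R c \<partial>L) = c"
      using integral_\<rho> integrable_\<rho> by simp
    finally show ?thesis by simp
  qed
  have r_le: "norm (r y) \<le> B' * tv k y" if y: "y \<in> space (P k)" for y
  proof -
    have "norm (r y) \<le> (\<integral>u. norm ((\<psi> k y u - \<rho> u) *\<^sub>R (e u - c)) \<partial>L)"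
      unfolding r_def by (rule integral_norm_bound)
    also have "\<dots> \<le> (\<integral>u. B' * \<bar>\<psi> k y u - \<rho> u\<bar> \<partial>L)"
    proof (rule integral_mono')
      show "integrable L (\<lambda>u. B' * \<bar>\<psi> k y u - \<rho> u\<bar>)"
        using integrable_\<psi>[OF y] integrable_\<rho> by auto
      show "norm ((\<psi> k y u - \<rho> u) *\<^sub>R (e u - c)) \<le> B' * \<bar>\<psi> k y u - \<rho> u\<bar>" if "u \<in> space L" for u
        using e_c[of u] that by (simp add: mult.commute[of B'] mult_left_mono)
      show "0 \<le> B' * \<bar>\<psi> k y u - \<rho> u\<bar>" for u using B0 by simp
    qed
    finally show ?thesis by (simp add: tv_def)
  qed
  have Zr_le: "norm (Z y * r y) \<le> B' * tv k y" if y: "y \<in> space (P k)" for y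
  proof -
    have "norm (Z y * r y) \<le> norm (Z y) * norm (r y)" by (rule norm_mult_ineq)
    also have "\<dots> \<le> 1 * (B' * tv k y)" using Z[OF y] r_le[OF y] by (intro mult_mono) auto
    finally show ?thesis by simp
  qed
  have Zr_int: "integrable M (\<lambda>\<omega>. Z (past_points k \<omega>) * r (past_points k \<omega>))"
  proof (rule Bochner_Integration.integrable_bound[of _ "\<lambda>\<omega>. B' * tv k (past_points k \<omega>)"])
    show "AE \<omega> in M. norm (Z (past_points k \<omega>) * r (past_points k \<omega>)) \<le> norm (B' * tv k (past_points k \<omega>))"
      using Zr_le[OF past_points_space] tv_nonneg B0 by (intro AE_I2) (simp add: abs_mult)
  qed (use integrable_tv in auto)
  have "(\<integral>\<omega>. Z (past_points k \<omega>) * e (X (Suc k) \<omega>) \<partial>M)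
      = (\<integral>\<omega>. (\<integral>u. \<psi> k (past_points k \<omega>) u *\<^sub>R (Z (past_points k \<omega>) * e u) \<partial>L) \<partial>M)"
  proof (rule integral_next[of "\<lambda>y u. Z y * e u" k B])
    show "norm (Z y * e u) \<le> B" if "y \<in> space (P k)" "u \<in> D" for y u
      using order_trans[OF norm_mult_ineq mult_mono[OF Z[OF that(1)] e[OF that(2)]]] by simp
  qed measurable
  also have "\<dots> = (\<integral>\<omega>. Z (past_points k \<omega>) * r (past_points k \<omega>)
      + Z (past_points k \<omega>) * (\<integral>u. \<rho> u *\<^sub>R e u \<partial>L) \<partial>M)"
  proof (rule Bochner_Integration.integral_cong[OF refl])
    fix \<omega> assume "\<omega> \<in> space M"
    then have y: "past_points k \<omega> \<in> space (P k)" (is "?y \<in> _") by (rule past_points_space)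
    have "(\<integral>u. \<psi> k ?y u *\<^sub>R (Z ?y * e u) \<partial>L) = Z ?y * (\<integral>u. \<psi> k ?y u *\<^sub>R e u \<partial>L)"
      using integrable_\<psi>_mult[OF y _ e] by (simp flip: mult_scaleR_right)
    then show "(\<integral>u. \<psi> k ?y u *\<^sub>R (Z ?y * e u) \<partial>L) = Z ?y * r ?y + Z ?y * (\<integral>u. \<rho> u *\<^sub>R e u \<partial>L)"
      by (simp add: r_eq[OF y] algebra_simps)
  qed
  also have "\<dots> = (\<integral>\<omega>. Z (past_points k \<omega>) * r (past_points k \<omega>) \<partial>M)
      + (\<integral>\<omega>. Z (past_points k \<omega>) \<partial>M) * (\<integral>u. \<rho> u *\<^sub>R e u \<partial>L)"
    using Zr_int Zint by simp
  finally have "(\<integral>\<omega>. Z (past_points k \<omega>) * e (X (Suc k) \<omega>) \<partial>M)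
    - (\<integral>\<omega>. Z (past_points k \<omega>) \<partial>M) * (\<integral>u. \<rho> u *\<^sub>R e u \<partial>L)
    = (\<integral>\<omega>. Z (past_points k \<omega>) * r (past_points k \<omega>) \<partial>M)" by simp
  also have "norm \<dots> \<le> (\<integral>\<omega>. norm (Z (past_points k \<omega>) * r (past_points k \<omega>)) \<partial>M)"
    by (rule integral_norm_bound)
  also have "\<dots> \<le> (\<integral>\<omega>. B' * tv k (past_points k \<omega>) \<partial>M)"
    using Zr_int integrable_tv Zr_le[OF past_points_space] by (intro integral_mono) auto
  also have "\<dots> = B' * drift k" by (simp add: drift_def)
  finally show ?thesis .
qed

definition partial_sum :: "('a \<Rightarrow> real) \<Rightarrow> nat \<Rightarrow> 'w \<Rightarrow> real" where
  "partial_sum w m \<omega> = (\<Sum>k=1..m. w (X k \<omega>))"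

text \<open>Each mean is compared with its value under \<rho>, which is 0; this is the replacement
  estimate with trivial prefactor 1 and c = 0.\<close>

lemma mean_partial_sum_le:
  assumes [measurable]: "w \<in> borel_measurable L" and B: "\<And>u. u \<in> D \<Longrightarrow> \<bar>w u\<bar> \<le> B"
    and w0: "(\<integral>u. \<rho> u * w u \<partial>L) = 0"
  shows "\<bar>\<integral>\<omega>. partial_sum w m \<omega> \<partial>M\<bar> \<le> B * (\<Sum>k<m. drift k)"
proof -
  have int: "integrable M (\<lambda>\<omega>. w (X (Suc k) \<omega>))" for k
    using B[OF X_in_D] by (intro integrable_const_bound[of _ B]) auto
  have one: "\<bar>\<integral>\<omega>. w (X (Suc k) \<omega>) \<partial>M\<bar> \<le> B * drift k" for k
    using next_step_error[of "\<lambda>_. 1::real" k w B 0 B] B w0 by simp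
  have "(\<integral>\<omega>. partial_sum w m \<omega> \<partial>M) = (\<Sum>k<m. \<integral>\<omega>. w (X (Suc k) \<omega>) \<partial>M)"
    unfolding partial_sum_def One_nat_def sum.atLeast1_atMost_eq
    using int by (rule Bochner_Integration.integral_sum)
  also have "\<bar>\<dots>\<bar> \<le> (\<Sum>k<m. B * drift k)"
    by (rule order_trans[OF sum_abs sum_mono[OF one]])
  finally show ?thesis by (simp add: sum_distrib_left)
qed

text \<open>The last factor of the character is replaced by its mean q under \<rho>. The error
  accumulated so far is multiplied by q, whose norm is at most 1, so the errors of the single steps
  simply add.\<close>

lemma char_partial_sum_approx:
  fixes s :: real
  assumes w [measurable]: "w \<in> borel_measurable L" and B: "\<And>u. u \<in> D \<Longrightarrow> \<bar>w u\<bar> \<le> B"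
  defines "q \<equiv> (\<integral>u. \<rho> u *\<^sub>R iexp (s * w u) \<partial>L)"
  shows "norm ((\<integral>\<omega>. iexp (s * partial_sum w m \<omega>) \<partial>M) - q ^ m) \<le> \<bar>s\<bar> * B * (\<Sum>k<m. drift k)"
proof (induction m)
  case 0
  then show ?case by (simp add: partial_sum_def prob_space)
next
  case (Suc k)
  define Z where "Z = (\<lambda>y. iexp (s * (\<Sum>i=1..k. w (y i))))"
  have Z_past: "Z (past_points k \<omega>) = iexp (s * partial_sum w k \<omega>)" for \<omega>
    by (simp add: Z_def past_points_def partial_sum_def)
  have Z_meas [measurable]: "Z \<in> borel_measurable (P k)"
    unfolding Z_def by measurable
  have q1: "norm q \<le> 1"
  proof -
    have "norm q \<le> (\<integral>u. norm (\<rho> u *\<^sub>R iexp (s * w u)) \<partial>L)"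
      unfolding q_def by (rule integral_norm_bound)
    also have "\<dots> = (\<integral>u. \<rho> u \<partial>L)"
      using \<rho>_pos by (intro Bochner_Integration.integral_cong) (auto simp: less_imp_le)
    finally show ?thesis by (simp add: integral_\<rho>)
  qed
  define E where "E = (\<lambda>m. \<integral>\<omega>. iexp (s * partial_sum w m \<omega>) \<partial>M)"
  have "norm ((\<integral>\<omega>. Z (past_points k \<omega>) * iexp (s * w (X (Suc k) \<omega>)) \<partial>M)
      - (\<integral>\<omega>. Z (past_points k \<omega>) \<partial>M) * (\<integral>u. \<rho> u *\<^sub>R iexp (s * w u) \<partial>L)) \<le> (\<bar>s\<bar> * B) * drift k"
  proof (rule next_step_error[where B=1 and c=1 and e = "\<lambda>u. iexp (s * w u)"])
    show "norm (iexp (s * w u) - 1) \<le> \<bar>s\<bar> * B" if "u \<in> D" for u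
      using norm_iexp_minus_1_le[of "s * w u"] mult_left_mono[OF B[OF that], of "\<bar>s\<bar>"]
      by (simp add: abs_mult)
  qed (auto simp: Z_def)
  moreover have "Z (past_points k \<omega>) * iexp (s * w (X (Suc k) \<omega>)) = iexp (s * partial_sum w (Suc k) \<omega>)" for \<omega>
    by (simp add: Z_past partial_sum_def exp_add[symmetric] algebra_simps)
  ultimately have step: "norm (E (Suc k) - E k * q) \<le> (\<bar>s\<bar> * B) * drift k"
    by (simp add: E_def Z_past q_def)
  have "norm (E (Suc k) - q ^ Suc k) = norm ((E (Suc k) - E k * q) + (E k - q ^ k) * q)"
    by (simp add: algebra_simps)
  also have "\<dots> \<le> norm (E (Suc k) - E k * q) + norm ((E k - q ^ k) * q)" by (rule norm_triangle_ineq)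
  also have "norm ((E k - q ^ k) * q) \<le> norm (E k - q ^ k) * 1"
    unfolding norm_mult using q1 by (intro mult_left_mono) auto
  \<comment> \<open>In the last sum the bound variable shadows its own upper limit, which is the
    \<open>k\<close> fixed by the induction.\<close>
  also have "norm (E (Suc k) - E k * q) + norm (E k - q ^ k) * 1
      \<le> (\<bar>s\<bar> * B) * drift k + \<bar>s\<bar> * B * (\<Sum>k<k. drift k)"
    using step Suc.IH by (intro add_mono) (auto simp: E_def)
  finally show ?case by (simp add: E_def algebra_simps)
qed

text \<open>Second-order Taylor expansion of the character: the linear term vanishes because
  \<open>w\<close> has mean 0 under \<rho>, and the cubic remainder is bounded uniformly on
  D.\<close>

lemma char_limit_law_expansion:
  assumes w [measurable]: "w \<in> borel_measurable L" and B: "\<And>u. u \<in> D \<Longrightarrow> \<bar>w u\<bar> \<le> B"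
    and w0: "(\<integral>u. \<rho> u * w u \<partial>L) = 0"
  shows "norm ((\<integral>u. \<rho> u *\<^sub>R iexp (s * w u) \<partial>L) - (1 - s\<^sup>2 * (\<integral>u. \<rho> u * (w u)\<^sup>2 \<partial>L) / 2))
    \<le> \<bar>s\<bar> ^ 3 * B ^ 3 / 6"
proof -
  have i0: "integrable L (\<lambda>u. \<rho> u *\<^sub>R iexp (s * w u))" by (rule integrable_\<rho>_scaleR[where A=1]) auto
  have i1: "integrable L (\<lambda>u. \<rho> u *\<^sub>R complex_of_real (w u))" by (rule integrable_\<rho>_scaleR[where A=B]) (use B in auto)
  have i2: "integrable L (\<lambda>u. \<rho> u *\<^sub>R complex_of_real ((w u)\<^sup>2))"
    by (rule integrable_\<rho>_scaleR[where A="B\<^sup>2"]) (use power_mono[OF B abs_ge_zero, of _ 2] in \<open>auto simp: norm_power\<close>)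
  have i3: "integrable L (\<lambda>u. \<rho> u *\<^sub>R (1::complex))" by (rule integrable_\<rho>_scaleR[where A=1]) auto
  define T where "T = (\<lambda>u. iexp (s * w u) - (1 + \<i> * complex_of_real (s * w u) - complex_of_real ((s * w u)\<^sup>2) / 2))"
  have T_le: "norm (T u) \<le> \<bar>s\<bar> ^ 3 * B ^ 3 / 6" if "u \<in> D" for u
  proof -
    have "norm (T u) \<le> \<bar>s * w u\<bar> ^ 3 / 6"
      unfolding T_def by (rule norm_iexp_minus_quadratic_le)
    also have "\<dots> = \<bar>s\<bar> ^ 3 * \<bar>w u\<bar> ^ 3 / 6" by (simp add: abs_mult power_mult_distrib)
    also have "\<dots> \<le> \<bar>s\<bar> ^ 3 * B ^ 3 / 6"
      using B[OF that] by (intro divide_right_mono mult_left_mono power_mono) auto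
    finally show ?thesis .
  qed
  have m1: "(\<integral>u. \<rho> u *\<^sub>R complex_of_real (w u) \<partial>L) = 0"
    using w0 by (simp add: scaleR_conv_of_real integral_of_real flip: of_real_mult)
  have m2: "(\<integral>u. \<rho> u *\<^sub>R complex_of_real ((w u)\<^sup>2) \<partial>L) = complex_of_real (\<integral>u. \<rho> u * (w u)\<^sup>2 \<partial>L)"
    by (simp add: scaleR_conv_of_real flip: integral_of_real of_real_mult of_real_power)
  have m3: "(\<integral>u. \<rho> u *\<^sub>R (1::complex) \<partial>L) = 1"
    using integral_\<rho> integrable_\<rho> by simp
  have "(\<integral>u. \<rho> u *\<^sub>R T u \<partial>L) = (\<integral>u. \<rho> u *\<^sub>R iexp (s * w u) - (\<rho> u *\<^sub>R 1
      + (\<i> * complex_of_real s) * (\<rho> u *\<^sub>R complex_of_real (w u))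
      - complex_of_real (s\<^sup>2 / 2) * (\<rho> u *\<^sub>R complex_of_real ((w u)\<^sup>2))) \<partial>L)"
    unfolding T_def by (intro Bochner_Integration.integral_cong refl)
      (simp add: algebra_simps scaleR_conv_of_real power_mult_distrib)
  also have "\<dots> = (\<integral>u. \<rho> u *\<^sub>R iexp (s * w u) \<partial>L) - ((\<integral>u. \<rho> u *\<^sub>R (1::complex) \<partial>L)
      + (\<i> * complex_of_real s) * (\<integral>u. \<rho> u *\<^sub>R complex_of_real (w u) \<partial>L)
      - complex_of_real (s\<^sup>2 / 2) * (\<integral>u. \<rho> u *\<^sub>R complex_of_real ((w u)\<^sup>2) \<partial>L))"
    using i0 i1 i2 i3
    by (simp only: Bochner_Integration.integral_diff Bochner_Integration.integral_add
        integral_mult_right_zero integrable_mult_right Bochner_Integration.integrable_diff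
        Bochner_Integration.integrable_add)
  also have "\<dots> = (\<integral>u. \<rho> u *\<^sub>R iexp (s * w u) \<partial>L) - (1 - s\<^sup>2 * (\<integral>u. \<rho> u * (w u)\<^sup>2 \<partial>L) / 2)"
    unfolding m1 m2 m3 by simp
  finally have "norm ((\<integral>u. \<rho> u *\<^sub>R iexp (s * w u) \<partial>L) - (1 - s\<^sup>2 * (\<integral>u. \<rho> u * (w u)\<^sup>2 \<partial>L) / 2))
      = norm (\<integral>u. \<rho> u *\<^sub>R T u \<partial>L)" by simp
  also have "\<dots> \<le> (\<integral>u. norm (\<rho> u *\<^sub>R T u) \<partial>L)" by (rule integral_norm_bound)
  also have "\<dots> \<le> (\<integral>u. \<rho> u * (\<bar>s\<bar> ^ 3 * B ^ 3 / 6) \<partial>L)"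
  proof (rule integral_mono')
    show "integrable L (\<lambda>u. \<rho> u * (\<bar>s\<bar> ^ 3 * B ^ 3 / 6))" using integrable_\<rho> by simp
    show "norm (\<rho> u *\<^sub>R T u) \<le> \<rho> u * (\<bar>s\<bar> ^ 3 * B ^ 3 / 6)" if "u \<in> space L" for u
      using that \<rho>_pos[of u] T_le[of u] unfolding norm_scaleR by (simp add: mult_left_mono)
    then show "0 \<le> \<rho> u * (\<bar>s\<bar> ^ 3 * B ^ 3 / 6)" if "u \<in> space L" for u
      using that norm_ge_zero order_trans by blast
  qed
  also have "\<dots> = \<bar>s\<bar> ^ 3 * B ^ 3 / 6" using integral_\<rho> integrable_\<rho> by simp
  finally show ?thesis .
qed

text \<open>Three terms: the replacement error, of order the summed drift over sqrt m; the
  difference of the m-th powers of q and of 1 - v / (2 m), of order 1 / sqrt m; and the classical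
  exponential limit.\<close>

lemma char_partial_sum_tendsto:
  assumes w: "w \<in> borel_measurable L" and B: "\<And>u. u \<in> D \<Longrightarrow> \<bar>w u\<bar> \<le> B"
    and w0: "(\<integral>u. \<rho> u * w u \<partial>L) = 0"
    and drift: "(\<lambda>m. (\<Sum>k<m. drift k) / sqrt (real m)) \<longlonglongrightarrow> 0"
  shows "(\<lambda>m. \<integral>\<omega>. iexp (1 / sqrt (real m) * partial_sum w m \<omega>) \<partial>M)
    \<longlonglongrightarrow> complex_of_real (exp (- (\<integral>u. \<rho> u * (w u)\<^sup>2 \<partial>L) / 2))"
proof -
  define v where "v = (\<integral>u. \<rho> u * (w u)\<^sup>2 \<partial>L)"
  define q where "q = (\<lambda>m. \<integral>u. \<rho> u *\<^sub>R iexp (1 / sqrt (real m) * w u) \<partial>L)"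
  define p where "p = (\<lambda>m. 1 + (- v / 2) / real m)"
  have v: "v \<ge> 0" unfolding v_def using \<rho>_pos by (intro integral_nonneg_AE AE_I2) (auto simp: less_imp_le)
  have q1: "norm (q m) \<le> 1" for m
  proof -
    have "norm (q m) \<le> (\<integral>u. norm (\<rho> u *\<^sub>R iexp (1 / sqrt (real m) * w u)) \<partial>L)"
      unfolding q_def by (rule integral_norm_bound)
    also have "\<dots> = (\<integral>u. \<rho> u \<partial>L)"
      using \<rho>_pos by (intro Bochner_Integration.integral_cong) (auto simp: less_imp_le)
    finally show ?thesis by (simp add: integral_\<rho>)
  qed
  have "(\<lambda>m. complex_of_real (p m ^ m)) \<longlonglongrightarrow> complex_of_real (exp (- v / 2))"
    unfolding p_def by (intro tendsto_of_real tendsto_exp_limit_sequentially)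
  moreover have "(\<lambda>m. q m ^ m - complex_of_real (p m ^ m)) \<longlonglongrightarrow> 0"
  proof (rule Lim_null_comparison)
    show "\<forall>\<^sub>F m in sequentially. norm (q m ^ m - complex_of_real (p m ^ m)) \<le> B ^ 3 / 6 * (1 / sqrt (real m))"
    proof (rule eventually_sequentiallyI)
      \<comment> \<open>The threshold gives m > 0 and v \<le> m, so \<open>p m\<close> has modulus
        at most 1, as the comparison of m-th powers requires.\<close>
      fix m assume m: "m \<ge> nat \<lceil>v\<rceil> + 1"
      then have m0: "real m > 0" "v \<le> real m" by linarith+
      have p1: "norm (complex_of_real (p m)) \<le> 1"
      proof -
        have "0 \<le> v / (2 * real m)" "v / (2 * real m) \<le> 1" using m0 v by simp_all
        moreover have "p m = 1 - v / (2 * real m)" by (simp add: p_def)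
        ultimately show ?thesis unfolding norm_of_real by linarith
      qed
      have "norm (q m - p m) \<le> \<bar>1 / sqrt (real m)\<bar> ^ 3 * B ^ 3 / 6"
        using char_limit_law_expansion[OF w B w0, of "1 / sqrt (real m)"] m0
        by (simp add: q_def p_def v_def power_divide mult.commute)
      then have "real m * norm (q m - p m) \<le> real m * (\<bar>1 / sqrt (real m)\<bar> ^ 3 * B ^ 3 / 6)"
        using m0 by (intro mult_left_mono) auto
      also have "\<dots> = B ^ 3 / 6 * (real m * (1 / sqrt (real m)) ^ 3)" by simp
      also have "real m * (1 / sqrt (real m)) ^ 3 = 1 / sqrt (real m)"
        using m0 by (simp add: power3_eq_cube power_divide)
      finally have "real m * norm (q m - p m) \<le> B ^ 3 / 6 * (1 / sqrt (real m))" .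
      moreover have "norm (q m ^ m - complex_of_real (p m) ^ m) \<le> real m * norm (q m - p m)"
        by (rule norm_power_diff[OF q1 p1])
      ultimately show "norm (q m ^ m - complex_of_real (p m ^ m)) \<le> B ^ 3 / 6 * (1 / sqrt (real m))"
        by simp
    qed
    show "(\<lambda>m. B ^ 3 / 6 * (1 / sqrt (real m))) \<longlonglongrightarrow> 0"
      by (intro tendsto_mult_right_zero tendsto_divide_0[OF tendsto_const] filterlim_at_top_imp_at_infinity
          filterlim_compose[OF sqrt_at_top filterlim_real_sequentially])
  qed
  moreover have "(\<lambda>m. (\<integral>\<omega>. iexp (1 / sqrt (real m) * partial_sum w m \<omega>) \<partial>M) - q m ^ m) \<longlonglongrightarrow> 0"
  proof (rule Lim_null_comparison)
    show "\<forall>\<^sub>F m in sequentially. norm ((\<integral>\<omega>. iexp (1 / sqrt (real m) * partial_sum w m \<omega>) \<partial>M) - q m ^ m)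
        \<le> B * ((\<Sum>k<m. drift k) / sqrt (real m))"
      using char_partial_sum_approx[OF w B, of "1 / sqrt (real _)"]
      by (intro always_eventually allI) (simp add: q_def field_simps)
    show "(\<lambda>m. B * ((\<Sum>k<m. drift k) / sqrt (real m))) \<longlonglongrightarrow> 0"
      using tendsto_mult_left[OF drift, of B] by simp
  qed
  ultimately have "(\<lambda>m. ((\<integral>\<omega>. iexp (1 / sqrt (real m) * partial_sum w m \<omega>) \<partial>M) - q m ^ m)
      + ((q m ^ m - complex_of_real (p m ^ m)) + complex_of_real (p m ^ m))) \<longlonglongrightarrow> 0 + (0 + complex_of_real (exp (- v / 2)))"
    by (intro tendsto_add)
  then show ?thesis by (simp add: v_def)
qed

lemma integrable_\<rho>_mult:
  fixes g :: "'a \<Rightarrow> real"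
  assumes [measurable]: "g \<in> borel_measurable L" and B: "\<And>u. u \<in> D \<Longrightarrow> \<bar>g u\<bar> \<le> B"
  shows "integrable L (\<lambda>u. \<rho> u * g u)" "integrable L (\<lambda>u. \<rho> u * (g u)\<^sup>2)"
  using integrable_\<rho>_scaleR[of g B] integrable_\<rho>_scaleR[of "\<lambda>u. (g u)\<^sup>2" "B\<^sup>2"]
    B power_mono[OF B abs_ge_zero, of _ 2] by simp_all

lemma variance_\<rho>:
  fixes g :: "'a \<Rightarrow> real"
  assumes g: "g \<in> borel_measurable L" and B: "\<And>u. u \<in> D \<Longrightarrow> \<bar>g u\<bar> \<le> B"
  defines "c \<equiv> \<integral>u. \<rho> u * g u \<partial>L"
  shows "(\<integral>u. \<rho> u * (g u - c)\<^sup>2 \<partial>L) = (\<integral>u. \<rho> u * (g u)\<^sup>2 \<partial>L) - c\<^sup>2"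
proof -
  note int = integrable_\<rho>_mult[OF g B]
  have "(\<integral>u. \<rho> u * (g u - c)\<^sup>2 \<partial>L) = (\<integral>u. \<rho> u * (g u)\<^sup>2 - (2 * c) * (\<rho> u * g u) + c\<^sup>2 * \<rho> u \<partial>L)"
    by (intro Bochner_Integration.integral_cong) (auto simp: power2_eq_square algebra_simps)
  also have "\<dots> = (\<integral>u. \<rho> u * (g u)\<^sup>2 \<partial>L) - (2 * c) * c + c\<^sup>2"
    using int integrable_\<rho> integral_\<rho> by (simp add: c_def)
  finally show ?thesis by (simp add: power2_eq_square)
qed

text \<open>Centring at the actual means differs from centring each summand at the mean under \<rho>
  by a deterministic total \<open>e m\<close>. The latter is bounded by a multiple of the summed
  drift, hence o(sqrt m), and only produces a phase factor tending to 1.\<close>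

lemma char_centred_sum_tendsto:
  assumes g [measurable]: "g \<in> borel_measurable L" and B: "\<And>u. u \<in> D \<Longrightarrow> \<bar>g u\<bar> \<le> B"
    and drift: "(\<lambda>m. (\<Sum>k<m. drift k) / sqrt (real m)) \<longlonglongrightarrow> 0"
  shows "(\<lambda>m. \<integral>\<omega>. iexp (1 / sqrt (real m) * (\<Sum>k=1..m. g (X k \<omega>) - (\<integral>\<omega>'. g (X k \<omega>') \<partial>M))) \<partial>M)
    \<longlonglongrightarrow> complex_of_real (exp (- ((\<integral>u. \<rho> u * (g u)\<^sup>2 \<partial>L) - (\<integral>u. \<rho> u * g u \<partial>L)\<^sup>2) / 2))"
proof -
  define c where "c = (\<integral>u. \<rho> u * g u \<partial>L)"
  define w where "w = (\<lambda>u. g u - c)"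
  have [measurable]: "w \<in> borel_measurable L" unfolding w_def by measurable
  have w_le: "\<bar>w u\<bar> \<le> B + \<bar>c\<bar>" if "u \<in> D" for u
    using B[OF that] unfolding w_def by linarith
  note int = integrable_\<rho>_mult[OF g B]
  have w0: "(\<integral>u. \<rho> u * w u \<partial>L) = 0"
  proof -
    have "(\<integral>u. \<rho> u * w u \<partial>L) = (\<integral>u. \<rho> u * g u - \<rho> u * c \<partial>L)"
      by (simp add: w_def algebra_simps)
    also have "\<dots> = 0" using int integrable_\<rho> integral_\<rho> by (simp add: c_def)
    finally show ?thesis .
  qed
  have w2: "(\<integral>u. \<rho> u * (w u)\<^sup>2 \<partial>L) = (\<integral>u. \<rho> u * (g u)\<^sup>2 \<partial>L) - c\<^sup>2"
    unfolding w_def c_def by (rule variance_\<rho>[OF g B])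
  have gX: "integrable M (\<lambda>\<omega>. g (X k \<omega>))" if "k \<in> {1..m}" for k m
    using B X_in_D[of _ "k - 1"] X_measurable'[OF that] that
    by (intro integrable_const_bound[of _ B]) auto
  define e where "e = (\<lambda>m. \<integral>\<omega>. partial_sum w m \<omega> \<partial>M)"
  have centred: "(\<Sum>k=1..m. g (X k \<omega>) - (\<integral>\<omega>'. g (X k \<omega>') \<partial>M)) = partial_sum w m \<omega> - e m" for m \<omega>
  proof -
    have "e m = (\<Sum>k=1..m. \<integral>\<omega>'. w (X k \<omega>') \<partial>M)"
      unfolding e_def partial_sum_def using gX
      by (intro Bochner_Integration.integral_sum) (auto simp: w_def)
    also have "\<dots> = (\<Sum>k=1..m. (\<integral>\<omega>'. g (X k \<omega>') \<partial>M) - c)"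
    proof (rule sum.cong[OF refl])
      fix k assume "k \<in> {1..m}"
      from gX[OF this] show "(\<integral>\<omega>'. w (X k \<omega>') \<partial>M) = (\<integral>\<omega>'. g (X k \<omega>') \<partial>M) - c"
        by (simp add: w_def prob_space)
    qed
    finally show ?thesis by (simp add: partial_sum_def w_def sum_subtractf)
  qed
  have lim1: "(\<lambda>m. iexp (- (e m / sqrt (real m)))) \<longlonglongrightarrow> iexp (- 0)"
  proof -
    have "(\<lambda>m. e m / sqrt (real m)) \<longlonglongrightarrow> 0"
    proof (rule Lim_null_comparison)
      show "\<forall>\<^sub>F m in sequentially. norm (e m / sqrt (real m))
          \<le> (B + \<bar>c\<bar>) * ((\<Sum>k<m. drift k) / sqrt (real m))"
        using mean_partial_sum_le[OF \<open>w \<in> borel_measurable L\<close> w_le w0]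
        by (intro always_eventually allI) (simp add: e_def divide_right_mono)
      show "(\<lambda>m. (B + \<bar>c\<bar>) * ((\<Sum>k<m. drift k) / sqrt (real m))) \<longlonglongrightarrow> 0"
        using tendsto_mult_left[OF drift, of "B + \<bar>c\<bar>"] by simp
    qed
    then show ?thesis by (intro tendsto_intros)
  qed
  have "(\<lambda>m. iexp (- (e m / sqrt (real m))) * (\<integral>\<omega>. iexp (1 / sqrt (real m) * partial_sum w m \<omega>) \<partial>M))
      \<longlonglongrightarrow> iexp (- 0) * complex_of_real (exp (- (\<integral>u. \<rho> u * (w u)\<^sup>2 \<partial>L) / 2))"
    by (intro tendsto_mult lim1 char_partial_sum_tendsto[OF _ w_le w0 drift]) auto
  moreover have "iexp (- (e m / sqrt (real m))) * (\<integral>\<omega>. iexp (1 / sqrt (real m) * partial_sum w m \<omega>) \<partial>M)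
      = (\<integral>\<omega>. iexp (1 / sqrt (real m) * (\<Sum>k=1..m. g (X k \<omega>) - (\<integral>\<omega>'. g (X k \<omega>') \<partial>M))) \<partial>M)" for m
    unfolding centred
    by (subst integral_mult_right_zero[symmetric])
      (simp add: exp_add[symmetric] algebra_simps diff_divide_distrib)
  ultimately show ?thesis unfolding w2 by (simp add: c_def)
qed

section \<open>The quadratic form of the limiting covariance and the multivariate limit\<close>

lemma weighted_mean_eq: "weighted_mean D \<beta> g = (\<integral>u. \<rho> u * g u \<partial>L)"
proof -
  have "weighted_mean D \<beta> g = (1 / \<alpha>) * (\<integral>u. g u * \<beta> u \<partial>L)"
    by (simp add: weighted_mean_def set_integral_D \<alpha>_def)
  also have "\<dots> = (\<integral>u. (1 / \<alpha>) * (g u * \<beta> u) \<partial>L)" by simp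
  also have "\<dots> = (\<integral>u. \<rho> u * g u \<partial>L)"
    by (intro Bochner_Integration.integral_cong) (auto simp: \<rho>_def)
  finally show ?thesis .
qed

text \<open>The right-hand side is the variance under \<rho> of a linear combination of the test
  functions. This yields positive semidefiniteness and matches the Gaussian exponent with the limit
  of the characteristic functions.\<close>

lemma limit_cov_quadratic_form:
  fixes f :: "'q::finite \<Rightarrow> 'a \<Rightarrow> real"
  assumes f: "\<And>j. f j \<in> borel_measurable L" and B: "\<And>j u. u \<in> D \<Longrightarrow> \<bar>f j u\<bar> \<le> B j"
  shows "(\<Sum>i\<in>UNIV. \<Sum>j\<in>UNIV. t i * t j * limit_cov D \<beta> (f i) (f j)) =
    (\<integral>u. \<rho> u * (\<Sum>j\<in>UNIV. t j * f j u)\<^sup>2 \<partial>L) - (\<integral>u. \<rho> u * (\<Sum>j\<in>UNIV. t j * f j u) \<partial>L)\<^sup>2"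
proof -
  note f [measurable]
  have i1: "integrable L (\<lambda>u. \<rho> u * f j u)" for j
    by (rule integrable_\<rho>_mult[OF f B])
  have i2: "integrable L (\<lambda>u. \<rho> u * (f i u * f j u))" for i j
    using integrable_\<rho>_scaleR[of "\<lambda>u. f i u * f j u" "B i * B j"] B mult_mono[OF B B]
    by (simp add: abs_mult order_trans[OF abs_ge_zero B])
  have "(\<integral>u. \<rho> u * (\<Sum>j\<in>UNIV. t j * f j u)\<^sup>2 \<partial>L)
      = (\<integral>u. (\<Sum>i\<in>UNIV. \<Sum>j\<in>UNIV. (t i * t j) * (\<rho> u * (f i u * f j u))) \<partial>L)"
    by (intro Bochner_Integration.integral_cong refl, unfold power2_eq_square sum_product)
      (unfold sum_distrib_left, intro sum.cong refl, simp add: ac_simps)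
  also have "\<dots> = (\<Sum>i\<in>UNIV. \<Sum>j\<in>UNIV. (t i * t j) * (\<integral>u. \<rho> u * (f i u * f j u) \<partial>L))"
    using i2 by simp
  finally have 1: "(\<integral>u. \<rho> u * (\<Sum>j\<in>UNIV. t j * f j u)\<^sup>2 \<partial>L) = \<dots>" .
  have "(\<integral>u. \<rho> u * (\<Sum>j\<in>UNIV. t j * f j u) \<partial>L) = (\<integral>u. (\<Sum>j\<in>UNIV. t j * (\<rho> u * f j u)) \<partial>L)"
    by (intro Bochner_Integration.integral_cong refl) (simp add: sum_distrib_left mult.left_commute)
  also have "\<dots> = (\<Sum>j\<in>UNIV. t j * (\<integral>u. \<rho> u * f j u \<partial>L))"
    using i1 by simp
  finally have 2: "(\<integral>u. \<rho> u * (\<Sum>j\<in>UNIV. t j * f j u) \<partial>L)\<^sup>2 =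
      (\<Sum>i\<in>UNIV. \<Sum>j\<in>UNIV. (t i * t j) * ((\<integral>u. \<rho> u * f i u \<partial>L) * (\<integral>u. \<rho> u * f j u \<partial>L)))"
    by (simp add: power2_eq_square sum_product mult.assoc mult.left_commute)
  show ?thesis
    unfolding 1 2 sum_subtractf[symmetric] limit_cov_def weighted_mean_eq right_diff_distrib ..
qed

text \<open>The Cramer-Wold device: a projection of the vector of normalized sums is the normalized
  centred sum of the single bounded function \<open>g t\<close>, so the scalar limit applies for
  every t.\<close>

lemma central_limit:
  fixes f :: "'q::finite \<Rightarrow> 'a \<Rightarrow> real"
  assumes f: "\<And>j. f j \<in> borel_measurable L" and B: "\<And>j u. u \<in> D \<Longrightarrow> \<bar>f j u\<bar> \<le> B j"
    and drift: "(\<lambda>m. (\<Sum>k<m. drift k) / sqrt (real m)) \<longlonglongrightarrow> 0"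
  shows "\<exists>N :: (real ^ 'q) measure.
     centred_gaussian_with_cov N (\<lambda>i j. limit_cov D \<beta> (f i) (f j)) \<and>
     converges_in_distribution M
       (\<lambda>m \<omega>. \<chi> j. (1 / sqrt (real m)) *
          (\<Sum>k=1..m. f j (X k \<omega>) - (\<integral>\<omega>'. f j (X k \<omega>') \<partial>M))) N"
proof -
  note f [measurable]
  define K where "K = (\<lambda>i j. limit_cov D \<beta> (f i) (f j))"
  define g where "g = (\<lambda>t u. \<Sum>j\<in>UNIV. t j * f j u)"
  have g_meas [measurable]: "g t \<in> borel_measurable L" for t
    unfolding g_def by measurable
  have g_le: "\<bar>g t u\<bar> \<le> (\<Sum>j\<in>UNIV. \<bar>t j\<bar> * B j)" if "u \<in> D" for t u
    unfolding g_def using B[OF that]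
    by (intro order_trans[OF sum_abs] sum_mono) (simp add: abs_mult mult_left_mono)
  have quad: "(\<Sum>i\<in>UNIV. \<Sum>j\<in>UNIV. t i * t j * K i j)
      = (\<integral>u. \<rho> u * (g t u)\<^sup>2 \<partial>L) - (\<integral>u. \<rho> u * g t u \<partial>L)\<^sup>2" for t
    unfolding K_def g_def by (rule limit_cov_quadratic_form[OF f B])
  have sym: "K i j = K j i" for i j
    unfolding K_def limit_cov_def by (simp add: mult.commute)
  have psd: "(\<Sum>i\<in>UNIV. \<Sum>j\<in>UNIV. t i * t j * K i j) \<ge> 0" for t
  proof -
    have "0 \<le> (\<integral>u. \<rho> u * (g t u - (\<integral>u. \<rho> u * g t u \<partial>L))\<^sup>2 \<partial>L)"
      using \<rho>_pos by (intro integral_nonneg_AE AE_I2) (simp add: less_imp_le)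
    then show ?thesis unfolding quad by (simp only: variance_\<rho>[OF g_meas g_le])
  qed
  obtain N :: "(real ^ 'q) measure" where N: "prob_space N" "sets N = sets borel"
    "\<And>t. distr N borel (\<lambda>v. t \<bullet> v)
      = normal_law 0 (sqrt (\<Sum>i\<in>UNIV. \<Sum>j\<in>UNIV. t $ i * t $ j * K i j))"
    using exists_gaussian_projections[OF sym psd] by blast
  note gauss = gaussian_with_projections[OF sym psd N]
  define V :: "nat \<Rightarrow> 'w \<Rightarrow> real ^ 'q" where
    "V = (\<lambda>m \<omega>. \<chi> j. (1 / sqrt (real m)) * (\<Sum>k=1..m. f j (X k \<omega>) - (\<integral>\<omega>'. f j (X k \<omega>') \<partial>M)))"
  have fX_meas: "(\<lambda>\<omega>. f j (X k \<omega>)) \<in> borel_measurable M" if "k \<in> {1..m}" for j k m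
    by (rule measurable_compose[OF X_measurable'[OF that] f])
  have fX: "integrable M (\<lambda>\<omega>. f j (X k \<omega>))" if "k \<in> {1..m}" for j k m
    using B X_in_D[of _ "k - 1"] fX_meas[OF that] that
    by (intro integrable_const_bound[of _ "B j"]) auto
  have "converges_in_distribution M V N"
  proof (rule levy_continuity_euclidean[OF prob_space_axioms _ N(1,2)])
    show "V m \<in> borel_measurable M" for m
      unfolding V_def using fX_meas
      by (subst borel_measurable_euclidean_space)
        (auto simp: Basis_vec_def inner_axis intro!: borel_measurable_sum borel_measurable_divide
          borel_measurable_diff)
    fix t :: "real ^ 'q"
    have tV: "t \<bullet> V m \<omega> = 1 / sqrt (real m) *
        (\<Sum>k=1..m. g (($) t) (X k \<omega>) - (\<integral>\<omega>'. g (($) t) (X k \<omega>') \<partial>M))" for m \<omega>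
    proof -
      have "t \<bullet> V m \<omega> = 1 / sqrt (real m) *
          (\<Sum>j\<in>UNIV. \<Sum>k=1..m. t $ j * (f j (X k \<omega>) - (\<integral>\<omega>'. f j (X k \<omega>') \<partial>M)))"
        by (simp add: V_def inner_vec_def sum_distrib_left mult.left_commute)
      also have "(\<Sum>j\<in>UNIV. \<Sum>k=1..m. t $ j * (f j (X k \<omega>) - (\<integral>\<omega>'. f j (X k \<omega>') \<partial>M)))
          = (\<Sum>k=1..m. \<Sum>j\<in>UNIV. t $ j * (f j (X k \<omega>) - (\<integral>\<omega>'. f j (X k \<omega>') \<partial>M)))"
        by (rule sum.swap)
      also have "\<dots> = (\<Sum>k=1..m. g (($) t) (X k \<omega>) - (\<integral>\<omega>'. g (($) t) (X k \<omega>') \<partial>M))"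
      proof (rule sum.cong[OF refl])
        fix k assume "k \<in> {1..m}"
        then have "(\<integral>\<omega>'. g (($) t) (X k \<omega>') \<partial>M) = (\<Sum>j\<in>UNIV. t $ j * (\<integral>\<omega>'. f j (X k \<omega>') \<partial>M))"
          unfolding g_def using fX by (subst Bochner_Integration.integral_sum) auto
        then show "(\<Sum>j\<in>UNIV. t $ j * (f j (X k \<omega>) - (\<integral>\<omega>'. f j (X k \<omega>') \<partial>M)))
            = g (($) t) (X k \<omega>) - (\<integral>\<omega>'. g (($) t) (X k \<omega>') \<partial>M)"
          by (simp add: g_def right_diff_distrib sum_subtractf)
      qed
      finally show ?thesis .
    qed
    show "(\<lambda>m. \<integral>\<omega>. iexp (t \<bullet> V m \<omega>) \<partial>M) \<longlonglongrightarrow> (\<integral>v. iexp (t \<bullet> v) \<partial>N)"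
      unfolding tV gauss(2) quad by (rule char_centred_sum_tendsto[OF g_meas g_le drift])
  qed
  with gauss(1) show ?thesis unfolding V_def K_def by blast
qed

end

section \<open>From the hypotheses of the theorem to the standing assumptions\<close>

lemma bounded_measurable_onD:
  assumes "f \<in> bounded_measurable_on D"
  shows "f \<in> borel_measurable (restrict_space borel D)" "\<exists>B. \<forall>x\<in>D. \<bar>f x\<bar> \<le> B"
  using assms by (auto simp: bounded_measurable_on_def bounded_iff)

theorem theorem1p3:
  fixes D :: "'a::euclidean_space set"
    and R :: "'a \<Rightarrow> real"
    and \<beta>\<^sub>s :: "nat \<Rightarrow> 'a \<Rightarrow> real"
    and \<beta> :: "'a \<Rightarrow> real"
    and \<tau> :: "'a \<Rightarrow> real"
    and \<phi> :: "real \<Rightarrow> real"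
    and M :: "'w measure"
    and X :: "nat \<Rightarrow> 'w \<Rightarrow> 'a"
    and f :: "'q::finite \<Rightarrow> 'a \<Rightarrow> real"
  assumes D_compact: "compact D"
    and D_pos: "measure lborel D > 0"
    and R_meas: "R \<in> borel_measurable (restrict_space borel D)"
    and R_nonneg: "\<And>x. x \<in> D \<Longrightarrow> R x \<ge> 0"
    and R_inf: "(INF x\<in>D. R x) > 0"
    and \<beta>s_mem: "\<And>n. \<beta>\<^sub>s n \<in> bounded_measurable_on D"
    and \<beta>s_pos: "\<And>n x. x \<in> D \<Longrightarrow> \<beta>\<^sub>s n x > 0"
    and \<beta>s_bdd: "\<exists>C. \<forall>n. \<forall>x\<in>D. \<beta>\<^sub>s n x \<le> C"
    and \<beta>_mem: "\<beta> \<in> bounded_measurable_on D"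
    and \<beta>s_unif: "uniform_limit D \<beta>\<^sub>s \<beta> sequentially"
    and \<beta>_inf: "(INF x\<in>D. \<beta> x) > 0"
    and rate: "\<And>n x. x \<in> D \<Longrightarrow> \<bar>\<beta>\<^sub>s n x - \<beta> x\<bar> \<le> \<tau> x * \<phi> (real n)"
    and \<phi>_pos: "\<And>s. s \<ge> 0 \<Longrightarrow> \<phi> s > 0"
    and \<phi>_lim: "(\<phi> \<longlongrightarrow> 0) at_top"
    and \<phi>_sum: "\<And>\<delta>. \<delta> > 0 \<Longrightarrow>
          (\<lambda>n. (1 / sqrt (real n)) * (\<Sum>k=0..n. \<phi> (real k * \<delta>))) \<longlonglongrightarrow> 0"
    and \<tau>_mem: "\<tau> \<in> bounded_measurable_on D"
    and \<tau>_inf: "(INF x\<in>D. \<tau> x) > 0"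
    and M_prob: "prob_space M"
    and X_process: "sequential_point_process M D R \<beta>\<^sub>s X"
    and f_mem: "\<And>j. f j \<in> bounded_measurable_on D"
  shows "\<exists>N :: (real ^ 'q) measure.
     centred_gaussian_with_cov N (\<lambda>i j. limit_cov D \<beta> (f i) (f j)) \<and>
     converges_in_distribution M
       (\<lambda>m \<omega>. \<chi> j. (1 / sqrt (real m)) *
          (\<Sum>k=1..m. f j (X k \<omega>) - (\<integral>\<omega>'. f j (X k \<omega>') \<partial>M))) N"
proof -
  obtain C\<^sub>s where C\<^sub>s: "\<And>n x. x \<in> D \<Longrightarrow> \<beta>\<^sub>s n x \<le> C\<^sub>s" using \<beta>s_bdd by blast
  obtain C\<^sub>\<beta> where C\<^sub>\<beta>: "\<And>x. x \<in> D \<Longrightarrow> \<bar>\<beta> x\<bar> \<le> C\<^sub>\<beta>" using bounded_measurable_onD(2)[OF \<beta>_mem] by blast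
  obtain T where T: "\<And>x. x \<in> D \<Longrightarrow> \<bar>\<tau> x\<bar> \<le> T" using bounded_measurable_onD(2)[OF \<tau>_mem] by blast
  have "D \<noteq> {}" using D_pos by auto
  then have T0: "T \<ge> 0" using T by force
  \<comment> \<open>A real infimum is known to be a lower bound only for sets bounded below;
    nonnegativity provides this for R, and boundedness for \<beta>.\<close>
  have "bdd_below (R ` D)" using R_nonneg by (intro bdd_belowI[of _ 0]) auto
  then have R_ge: "(INF x\<in>D. R x) \<le> R x" if "x \<in> D" for x using that by (rule cINF_lower)
  have "bdd_below (\<beta> ` D)"
    using C\<^sub>\<beta> by (intro bdd_belowI[of _ "- C\<^sub>\<beta>"]) (force simp: abs_le_iff)
  then have \<beta>_ge: "(INF x\<in>D. \<beta> x) \<le> \<beta> x" if "x \<in> D" for x using that by (rule cINF_lower)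
  interpret prob_space M by fact
  interpret local_interaction M D R \<beta>\<^sub>s \<beta> "max C\<^sub>s C\<^sub>\<beta>" "INF x\<in>D. \<beta> x" "INF x\<in>D. R x" X
  proof
    show "\<beta>\<^sub>s n x \<le> max C\<^sub>s C\<^sub>\<beta>" if "x \<in> D" for n x using C\<^sub>s[OF that, of n] by simp
    show "\<beta> x \<le> max C\<^sub>s C\<^sub>\<beta>" if "x \<in> D" for x using C\<^sub>\<beta>[OF that] by simp
  qed (use assms R_ge \<beta>_ge bounded_measurable_onD(1) in blast)+
  obtain K where K: "\<And>m. (\<Sum>k<m. drift k) \<le> K * (\<Sum>j<m. \<phi> (real j))"
  proof (rule drift_sum_le[of "\<lambda>n. \<phi> (real n)" T])
    show "\<bar>\<beta>\<^sub>s n x - \<beta> x\<bar> \<le> T * \<phi> (real n)" if "x \<in> D" for n x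
    proof -
      have "\<tau> x * \<phi> (real n) \<le> T * \<phi> (real n)"
        using T[OF that] \<phi>_pos[of "real n"] by (intro mult_right_mono) auto
      then show ?thesis using rate[OF that, of n] by linarith
    qed
  qed (use T0 \<phi>_pos in \<open>auto simp: less_imp_le\<close>)
  have drift_lim: "(\<lambda>m. (\<Sum>k<m. drift k) / sqrt (real m)) \<longlonglongrightarrow> 0"
  proof (rule Lim_null_comparison)
    \<comment> \<open>The counts take consecutive integer values, so the summation hypothesis is
      applied with spacing 1. The absolute value of \<open>K\<close> saves a proof that the constant
      is nonnegative.\<close>
    show "(\<lambda>m. \<bar>K\<bar> * ((1 / sqrt (real m)) * (\<Sum>k=0..m. \<phi> (real k * 1)))) \<longlonglongrightarrow> 0"
      using tendsto_mult_left[OF \<phi>_sum[of 1], of "\<bar>K\<bar>"] by simp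
    show "\<forall>\<^sub>F m in sequentially. norm ((\<Sum>k<m. drift k) / sqrt (real m))
        \<le> \<bar>K\<bar> * ((1 / sqrt (real m)) * (\<Sum>k=0..m. \<phi> (real k * 1)))"
    \<comment> \<open>The bound holds for m = 0 as well, since division by sqrt 0 gives 0 on both
      sides.\<close>
    proof (intro always_eventually allI)
      fix m
      have \<phi>0: "\<phi> (real j) \<ge> 0" for j using \<phi>_pos[of "real j"] by simp
      have "(\<Sum>k<m. drift k) \<le> K * (\<Sum>j<m. \<phi> (real j))" by (rule K)
      also have "\<dots> \<le> \<bar>K\<bar> * (\<Sum>j<m. \<phi> (real j))"
        using \<phi>0 by (intro mult_right_mono sum_nonneg) auto
      also have "\<dots> \<le> \<bar>K\<bar> * (\<Sum>k=0..m. \<phi> (real k))"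
        using \<phi>0 by (intro mult_left_mono sum_mono2) auto
      finally have "(\<Sum>k<m. drift k) / sqrt (real m) \<le> (\<bar>K\<bar> * (\<Sum>k=0..m. \<phi> (real k))) / sqrt (real m)"
        by (intro divide_right_mono) auto
      moreover have "(\<Sum>k<m. drift k) \<ge> 0" using drift_nonneg by (intro sum_nonneg) auto
      ultimately show "norm ((\<Sum>k<m. drift k) / sqrt (real m))
          \<le> \<bar>K\<bar> * ((1 / sqrt (real m)) * (\<Sum>k=0..m. \<phi> (real k * 1)))"
        by simp
    qed
  qed
  have "\<forall>j. \<exists>B. \<forall>x\<in>D. \<bar>f j x\<bar> \<le> B" using bounded_measurable_onD(2)[OF f_mem] by blast
  then obtain B where B: "\<And>j x. x \<in> D \<Longrightarrow> \<bar>f j x\<bar> \<le> B j" by metis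
  show ?thesis
  proof (rule central_limit[OF _ B drift_lim])
    show "f j \<in> borel_measurable L" for j
      using bounded_measurable_onD(1)[OF f_mem] by (simp add: measurable_L_iff)
  qed
qed

end
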